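(* Let $s=s(n)$ satisfy $\log(n)\ll s\leq n$. Then the threshold bias of the rainbow-connectivity game $\mathcal{C}_{s,n}$ satisfies $$\left(\tfrac12-o(1)\right)\frac{sn}{\log(n)}\leq b_{\mathcal{C}_{s,n}}\leq (1+o(1))\frac{sn}{\log(n)}.$$
   Context: $\log$ is the natural logarithm; $f\ll g$ means $f(n)/g(n)\to 0$, and $o(1)$ denotes a quantity tending to $0$ as $n\to\infty$. A $(1:b)$ Maker-Breaker game on a finite board $X$ with a family of winning sets: Maker and Breaker alternately claim unclaimed elements of $X$, Maker $1$ per round and Breaker $b$ per round, until all are claimed; Maker wins if she claims all elements of some winning set, otherwise Breaker wins. The threshold bias is the unique integer $b_0$ such that Breaker wins the $(1:b)$ game iff $b\geq b_0$. For integers $1\leq s\leq n$, the rainbow-connectivity game $\mathcal{C}_{s,n}$ is played on the board $X=\bigcup_{i\in[s]}E(G_i)$, where $G_1,\dots,G_s$ are distinct copies of $K_n$ on the common vertex set $V=[n]$; an edge of $G_i$ has color $i$. Maker wins iff at the end every two vertices of $V$ are joined by a path of Maker's edges whose edges have pairwise distinct colors. *)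

theory Defs
  imports Complex_Main
begin

text \<open>A position is given by the sets M (Maker's elements) and B (Breaker's elements),
  with Maker to move. Maker claims one free element; then Breaker claims b free elements
  (or all remaining ones if fewer than b are left). When no free element is left, Maker
  wins iff she has claimed all elements of some winning set.\<close>

inductive maker_wins_from :: "'a set \<Rightarrow> 'a set set \<Rightarrow> nat \<Rightarrow> 'a set \<Rightarrow> 'a set \<Rightarrow> bool"
  for X :: "'a set" and F :: "'a set set" and b :: nat where
  finished: "X - (M \<union> B) = {} \<Longrightarrow> (\<exists>A\<in>F. A \<subseteq> M) \<Longrightarrow> maker_wins_from X F b M B"
| move: "x \<in> X - (M \<union> B) \<Longrightarrow>
    (\<forall>D. D \<subseteq> X - (M \<union> B) - {x} \<and> card D = min b (card (X - (M \<union> B) - {x}))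
          \<longrightarrow> maker_wins_from X F b (insert x M) (B \<union> D)) \<Longrightarrow>
    maker_wins_from X F b M B"

definition maker_wins :: "'a set \<Rightarrow> 'a set set \<Rightarrow> nat \<Rightarrow> bool" where
  "maker_wins X F b = maker_wins_from X F b {} {}"

definition threshold_bias :: "'a set \<Rightarrow> 'a set set \<Rightarrow> nat" where
  "threshold_bias X F = (LEAST b. \<not> maker_wins X F b)"

text \<open>Vertices are 0..n-1, colours 0..s-1; an edge of colour i is a pair (i, e) with e a
  2-subset of the vertex set (an edge of the i-th copy of K_n).\<close>
definition rc_board :: "nat \<Rightarrow> nat \<Rightarrow> (nat \<times> nat set) set" where
  "rc_board s n = {(i, e). i < s \<and> e \<subseteq> {..<n} \<and> card e = 2}"

definition rainbow_path :: "(nat \<times> nat set) set \<Rightarrow> nat \<Rightarrow> nat \<Rightarrow> bool" where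
  "rainbow_path M x y \<longleftrightarrow> (\<exists>vs cs. length vs = length cs + 1 \<and> hd vs = x \<and> last vs = y \<and>
      distinct vs \<and> distinct cs \<and> (\<forall>k < length cs. (cs ! k, {vs ! k, vs ! Suc k}) \<in> M))"

definition rainbow_connected :: "nat \<Rightarrow> (nat \<times> nat set) set \<Rightarrow> bool" where
  "rainbow_connected n M \<longleftrightarrow> (\<forall>x < n. \<forall>y < n. x \<noteq> y \<longrightarrow> rainbow_path M x y)"

definition rc_winning_sets :: "nat \<Rightarrow> nat \<Rightarrow> (nat \<times> nat set) set set" where
  "rc_winning_sets s n = {A. A \<subseteq> rc_board s n \<and> rainbow_connected n A}"

definition rc_threshold :: "nat \<Rightarrow> nat \<Rightarrow> nat" where
  "rc_threshold s n = threshold_bias (rc_board s n) (rc_winning_sets s n)"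

end

(* Breaker isolates a vertex: he first occupies all edges inside a set of about n / (4 ln n)
   vertices untouched by Maker, which grows by one vertex per round, and then plays the box game on
   the stars of these vertices, spending b div k on each of them when k are left; the harmonic sum
   of these amounts exceeds s n.

   Maker reserves a small proportion of the colours and first gives every vertex v a set of 16 Q
   out-edges of distinct unreserved colours, where Q is a small multiple of ln n. She always plays
   at the vertex v with the largest value of d_B(v) - 2 b |out v|. Averaging over sets of unfinished
   vertices shows that this value stays below 2 b H_n, so a constant fraction of the edges at v is
   still free; this is where the constant 1/2 comes from. Among the free edges she picks one
   that does not increase an exponential potential counting the pairs (A, W) with |W| = Q |A| such
   that the vertices of A send at least half of their out-edges into W. The potential starts below 1,
   hence at the end every small set expands by the factor Q, even after deleting at each vertex the
   few out-edges whose colour has been used on the way or is forbidden. So every vertex reaches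
   linearly many vertices by rainbow walks avoiding any given small colour set, and for all x, y
   there are of order s n^2 edges of reserved colour that would join a rainbow walk from x to a
   colour-disjoint rainbow walk from y. Up to then Breaker has claimed only a small fraction of them,
   and Beck's potential 2^(-|E - B| / b) lets Maker hit all these sets of edges. *)

theory Submission
  imports Defs "HOL-Analysis.Analysis" "HOL-Real_Asymp.Real_Asymp"
begin

section \<open>Breaker's strategy\<close>

text \<open>A strategy is given by an invariant \<open>I\<close>; the number of free elements
  decreases. Replies of size at most \<open>b\<close> include the shorter one of the last round, and
  the first disjunct of the step permits a switch to another strategy.\<close>

lemma maker_wins_from_strategy:
  assumes "finite X" and "I M B"
    and step: "\<And>M B. I M B \<Longrightarrow> maker_wins_from X F b M B \<or>
      (\<exists>x \<in> X - (M \<union> B). \<forall>D. D \<subseteq> X - (M \<union> B) - {x} \<and> card D \<le> b \<longrightarrow> I (insert x M) (B \<union> D))"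
  shows "maker_wins_from X F b M B"
  using \<open>I M B\<close>
proof (induction "card (X - (M \<union> B))" arbitrary: M B rule: less_induct)
  case less
  show ?case
  proof (cases "maker_wins_from X F b M B")
    case False
    then obtain x where x: "x \<in> X - (M \<union> B)"
      and D: "\<And>D. D \<subseteq> X - (M \<union> B) - {x} \<Longrightarrow> card D \<le> b \<Longrightarrow> I (insert x M) (B \<union> D)"
      using step[OF less.prems] by blast
    show ?thesis
    proof (rule maker_wins_from.move[OF x], intro allI impI)
      fix D assume *: "D \<subseteq> X - (M \<union> B) - {x} \<and> card D = min b (card (X - (M \<union> B) - {x}))"
      have "X - (insert x M \<union> (B \<union> D)) \<subset> X - (M \<union> B)"
        using x by blast
      then have "card (X - (insert x M \<union> (B \<union> D))) < card (X - (M \<union> B))"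
        using \<open>finite X\<close> by (intro psubset_card_mono) auto
      then show "maker_wins_from X F b (insert x M) (B \<union> D)"
        using less.hyps D * by auto
    qed
  qed simp
qed

text \<open>One round of Breaker's play. He names only the elements \<open>D\<close> that matter to
  him; the rules make him fill up the round, so the outcome must be good for every larger reply
  \<open>D'\<close>.\<close>

lemma not_maker_wins_fromI:
  assumes "finite X"
    and fin: "X - (M \<union> B) = {} \<Longrightarrow> \<forall>A\<in>F. \<not> A \<subseteq> M"
    and step: "\<And>x. x \<in> X - (M \<union> B) \<Longrightarrow> \<exists>D \<subseteq> X - (M \<union> B) - {x}. card D \<le> b \<and>
      (\<forall>D'. D \<subseteq> D' \<and> D' \<subseteq> X - (M \<union> B) - {x} \<longrightarrow> \<not> maker_wins_from X F b (insert x M) (B \<union> D'))"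
  shows "\<not> maker_wins_from X F b M B"
proof
  assume "maker_wins_from X F b M B"
  then show False
  proof cases
    case finished
    then show ?thesis using fin by auto
  next
    case (move x)
    let ?R = "X - (M \<union> B) - {x}"
    obtain D where D: "D \<subseteq> ?R" "card D \<le> b"
      "\<And>D'. D \<subseteq> D' \<Longrightarrow> D' \<subseteq> ?R \<Longrightarrow> \<not> maker_wins_from X F b (insert x M) (B \<union> D')"
      using step[OF move(1)] by meson
    have "finite ?R" using \<open>finite X\<close> by auto
    then have "card D \<le> min b (card ?R)" using D by (simp add: card_mono)
    then obtain D' where "D \<subseteq> D'" "D' \<subseteq> ?R" "card D' = min b (card ?R)"
      using exists_subset_between[of D "min b (card ?R)" ?R] D(1) \<open>finite ?R\<close> by auto
    then show False using D(3) move(2) by blast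
  qed
qed

text \<open>It suffices to follow one play with arbitrary replies of Breaker: Maker claims nothing
  from \<open>B\<close>, so the set she completes avoids \<open>S\<close>.\<close>

lemma maker_wins_from_avoids:
  assumes "finite X"
  shows "maker_wins_from X F b M B \<Longrightarrow> S \<subseteq> B \<Longrightarrow> S \<inter> M = {} \<Longrightarrow> \<exists>A\<in>F. A \<inter> S = {}"
proof (induction rule: maker_wins_from.induct)
  case (finished M B)
  then show ?case by blast
next
  case (move x M B)
  let ?R = "X - (M \<union> B) - {x}"
  obtain D where "D \<subseteq> ?R" "card D = min b (card ?R)"
    using obtain_subset_with_card_n[of "min b (card ?R)" ?R] by auto
  then show ?case using move by blast
qed

section \<open>Vertex stars as the boxes of the box game\<close>

definition rc_star :: "nat \<Rightarrow> nat \<Rightarrow> nat \<Rightarrow> (nat \<times> nat set) set" where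
  "rc_star s n v = {p \<in> rc_board s n. v \<in> snd p}"

lemma finite_rc_board [simp]: "finite (rc_board s n)"
proof (rule finite_subset)
  show "rc_board s n \<subseteq> {..<s} \<times> Pow {..<n}"
    unfolding rc_board_def by auto
qed simp

lemma rc_board_memE:
  assumes "p \<in> rc_board s n"
  obtains i u v where "p = (i, {u, v})" "u \<noteq> v" "u < n" "v < n" "i < s"
  using assms unfolding rc_board_def by (auto simp: card_2_iff)

lemma rc_board_iff [simp]: "(i, {u, v}) \<in> rc_board s n \<longleftrightarrow> i < s \<and> u < n \<and> v < n \<and> u \<noteq> v"
  unfolding rc_board_def by (auto simp: card_2_iff')

lemma rc_star_subset: "rc_star s n v \<subseteq> rc_board s n"
  by (auto simp: rc_star_def)

lemma finite_rc_star [simp]: "finite (rc_star s n v)"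
  using finite_rc_board rc_star_subset by (rule finite_subset[rotated])

lemma rc_star_eq:
  assumes "v < n"
  shows "rc_star s n v = (\<lambda>(i, w). (i, {v, w})) ` ({..<s} \<times> ({..<n} - {v}))"
proof (intro equalityI subsetI)
  fix p assume "p \<in> rc_star s n v"
  then have p: "p \<in> rc_board s n" "v \<in> snd p" by (auto simp: rc_star_def)
  then obtain i u w where "p = (i, {u, w})" "u \<noteq> w" "u < n" "w < n" "i < s"
    using rc_board_memE by metis
  then show "p \<in> (\<lambda>(i, w). (i, {v, w})) ` ({..<s} \<times> ({..<n} - {v}))"
    using p by (auto simp: insert_commute image_iff)
qed (use assms in \<open>auto simp: rc_star_def\<close>)

lemma card_rc_star:
  assumes "v < n"
  shows "card (rc_star s n v) = s * (n - 1)"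
proof -
  have "inj_on (\<lambda>(i, w). (i, {v, w})) ({..<s} \<times> ({..<n} - {v}))"
    by (auto simp: inj_on_def doubleton_eq_iff)
  then show ?thesis
    using assms by (simp add: rc_star_eq card_image card_cartesian_product)
qed

text \<open>The first edge of a path from \<open>v\<close> to some other vertex lies in the star of
  \<open>v\<close>.\<close>

lemma rainbow_connected_meets_star:
  assumes "A \<in> rc_winning_sets s n" "v < n" "2 \<le> n"
  shows "A \<inter> rc_star s n v \<noteq> {}"
proof -
  have A: "A \<subseteq> rc_board s n" "rainbow_connected n A"
    using assms by (auto simp: rc_winning_sets_def)
  obtain w where "w < n" "w \<noteq> v"
    using assms(3) by (cases "v = 0") (auto intro: that[of 0] that[of 1])
  then have "rainbow_path A v w" using A(2) assms by (auto simp: rainbow_connected_def)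
  then obtain vs cs where vs: "length vs = length cs + 1" "hd vs = v" "last vs = w"
    "\<forall>k < length cs. (cs ! k, {vs ! k, vs ! Suc k}) \<in> A"
    unfolding rainbow_path_def by auto
  have "cs \<noteq> []"
  proof
    assume "cs = []"
    then have "length vs = 1" using vs by simp
    then have "hd vs = last vs" by (cases vs) auto
    then show False using vs \<open>w \<noteq> v\<close> by simp
  qed
  then have "(cs ! 0, {vs ! 0, vs ! Suc 0}) \<in> A" using vs by auto
  moreover have "vs ! 0 = v" using vs by (metis add_is_0 hd_conv_nth length_0_conv one_neq_zero)
  ultimately show ?thesis using A(1) by (force simp: rc_star_def)
qed

lemma breaker_wins_isolated:
  assumes "v < n" "2 \<le> n" "rc_star s n v \<subseteq> B" "rc_star s n v \<inter> M = {}"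
  shows "\<not> maker_wins_from (rc_board s n) (rc_winning_sets s n) b M B"
  using maker_wins_from_avoids[OF finite_rc_board _ assms(3,4)] rainbow_connected_meets_star assms(1,2)
  by blast

text \<open>Box game with Maker to move. A free edge lies in at most one of the stars, so Maker
  spoils at most one per move. Breaker spreads his \<open>b\<close> edges evenly over the others,
  which removes one summand \<open>b div j\<close> from the bound. When one star is left, nothing of
  it is free.\<close>

lemma breaker_wins_box:
  assumes "C \<subseteq> {..<n}" "card C = Suc k" "2 \<le> n"
    and "\<And>v. v \<in> C \<Longrightarrow> rc_star s n v \<inter> M = {}"
    and "\<And>u v. u \<in> C \<Longrightarrow> v \<in> C \<Longrightarrow> u \<noteq> v \<Longrightarrow> rc_star s n u \<inter> rc_star s n v \<subseteq> B"
    and "\<And>v. v \<in> C \<Longrightarrow> card (rc_star s n v - B) \<le> (\<Sum>j=1..k. b div j)"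
  shows "\<not> maker_wins_from (rc_board s n) (rc_winning_sets s n) b M B"
  using assms
proof (induction k arbitrary: C M B)
  case 0
  then obtain v where v: "C = {v}" by (metis One_nat_def card_1_singletonE)
  then have "rc_star s n v - B = {}" using 0(6)[of v] by simp
  then show ?case using 0 v by (intro breaker_wins_isolated[of v]) auto
next
  case (Suc k)
  let ?X = "rc_board s n"
  have finC: "finite C" using Suc.prems(1) finite_subset by blast
  show ?case
  proof (rule not_maker_wins_fromI)
    fix x assume x: "x \<in> ?X - (M \<union> B)"
    \<comment> \<open>One star is dropped in any case: the one hit by \<open>x\<close>, or an
      arbitrary one if \<open>x\<close> hits none.\<close>
    have "\<exists>C' \<subseteq> C. card C' = Suc k \<and> (\<forall>v\<in>C'. x \<notin> rc_star s n v)"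
    proof (cases "\<exists>v\<in>C. x \<in> rc_star s n v")
      case True
      then obtain v where v: "v \<in> C" "x \<in> rc_star s n v" by blast
      then have "\<forall>u\<in>C - {v}. x \<notin> rc_star s n u"
        using Suc.prems(5)[of _ v] x by blast
      moreover have "card (C - {v}) = Suc k" using v Suc.prems(2) finC by simp
      ultimately show ?thesis by blast
    next
      case False
      obtain C' where "C' \<subseteq> C" "card C' = Suc k"
        using obtain_subset_with_card_n[of "Suc k" C] Suc.prems(2) by auto
      then show ?thesis using False by blast
    qed
    then obtain C' where C': "C' \<subseteq> C" "card C' = Suc k" "\<And>v. v \<in> C' \<Longrightarrow> x \<notin> rc_star s n v"
      by blast
    have "\<forall>v\<in>C'. \<exists>D. D \<subseteq> rc_star s n v - B \<and> card D = min (b div Suc k) (card (rc_star s n v - B))"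
    proof
      fix v show "\<exists>D. D \<subseteq> rc_star s n v - B \<and> card D = min (b div Suc k) (card (rc_star s n v - B))"
        using obtain_subset_with_card_n[of "min (b div Suc k) (card (rc_star s n v - B))" "rc_star s n v - B"]
        by auto
    qed
    then obtain D where D: "\<And>v. v \<in> C' \<Longrightarrow> D v \<subseteq> rc_star s n v - B"
       "\<And>v. v \<in> C' \<Longrightarrow> card (D v) = min (b div Suc k) (card (rc_star s n v - B))"
      by metis
    have sub: "(\<Union>v\<in>C'. D v) \<subseteq> ?X - (M \<union> B) - {x}"
    proof
      fix p assume "p \<in> (\<Union>v\<in>C'. D v)"
      then obtain v where v: "v \<in> C'" "p \<in> D v" by blast
      then have "p \<in> rc_star s n v" "p \<notin> B" using D(1) by auto
      moreover from this have "p \<noteq> x" using C'(3) v by auto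
      ultimately show "p \<in> ?X - (M \<union> B) - {x}"
        using Suc.prems(4)[of v] v C'(1) rc_star_subset by blast
    qed
    have "finite C'" using C'(1) finC finite_subset by blast
    then have "card (\<Union>v\<in>C'. D v) \<le> (\<Sum>v\<in>C'. card (D v))" by (rule card_UN_le)
    also have "\<dots> \<le> (\<Sum>v\<in>C'. b div Suc k)" using D(2) by (intro sum_mono) auto
    also have "\<dots> \<le> b" using C'(2) using times_div_less_eq_dividend[of "Suc k" b] C'(2) by (simp del: times_div_less_eq_dividend)
    finally have cardD: "card (\<Union>v\<in>C'. D v) \<le> b" .
    show "\<exists>D \<subseteq> ?X - (M \<union> B) - {x}. card D \<le> b \<and>
      (\<forall>D'. D \<subseteq> D' \<and> D' \<subseteq> ?X - (M \<union> B) - {x} \<longrightarrow>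
        \<not> maker_wins_from ?X (rc_winning_sets s n) b (insert x M) (B \<union> D'))"
    proof (intro exI[of _ "\<Union>v\<in>C'. D v"] conjI allI impI sub cardD)
      fix D' assume D': "(\<Union>v\<in>C'. D v) \<subseteq> D' \<and> D' \<subseteq> ?X - (M \<union> B) - {x}"
      show "\<not> maker_wins_from ?X (rc_winning_sets s n) b (insert x M) (B \<union> D')"
      proof (rule Suc.IH[of C'])
        fix v assume v: "v \<in> C'"
        show "rc_star s n v \<inter> insert x M = {}" using v C' Suc.prems(4)[of v] by blast
        have "card (rc_star s n v - (B \<union> D')) \<le> card (rc_star s n v - B - D v)"
          using D' v by (intro card_mono) auto
        also have "\<dots> = card (rc_star s n v - B) - card (D v)"
          using D(1)[OF v] by (intro card_Diff_subset finite_subset[OF D(1)[OF v]]) auto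
        also have "\<dots> \<le> (\<Sum>j=1..k. b div j)"
          using Suc.prems(6)[of v] D(2)[OF v] v C'(1) by (auto simp: min_def)
        finally show "card (rc_star s n v - (B \<union> D')) \<le> (\<Sum>j=1..k. b div j)" .
      next
        fix u v assume "u \<in> C'" "v \<in> C'" "u \<noteq> v"
        then show "rc_star s n u \<inter> rc_star s n v \<subseteq> B \<union> D'"
          using Suc.prems(5) C'(1) by blast
      qed (use C' Suc.prems in auto)
    qed
  next
    assume full: "?X - (M \<union> B) = {}"
    obtain v where v: "v \<in> C" using Suc.prems(2) by fastforce
    then have "rc_star s n v \<subseteq> B" "rc_star s n v \<inter> M = {}"
      using Suc.prems(4)[of v] full rc_star_subset by blast+
    then show "\<forall>A\<in>rc_winning_sets s n. \<not> A \<subseteq> M"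
      using rainbow_connected_meets_star v Suc.prems(1,3) by blast
  qed simp
qed

text \<open>The number j of vertices still missing from the clique C decreases by one in each round. Maker
  may spoil one vertex of C, so Breaker adds up to two vertices.\<close>

lemma breaker_wins_clique:
  assumes "C \<subseteq> {..<n}" "card C + j = m" "1 \<le> m" "2 \<le> n" "3 * m + 5 \<le> n" "2 * s * m \<le> b"
    and "s * n \<le> (\<Sum>j=1..m-1. b div j)"
    and "M \<subseteq> rc_board s n" "card M \<le> card C"
    and "\<And>v. v \<in> C \<Longrightarrow> rc_star s n v \<inter> M = {}"
    and "\<And>u v. u \<in> C \<Longrightarrow> v \<in> C \<Longrightarrow> u \<noteq> v \<Longrightarrow> rc_star s n u \<inter> rc_star s n v \<subseteq> B"
  shows "\<not> maker_wins_from (rc_board s n) (rc_winning_sets s n) b M B"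
  using assms
proof (induction j arbitrary: C M B)
  case 0
  show ?case
  proof (rule breaker_wins_box[of C n "m - 1"])
    fix v assume v: "v \<in> C"
    have "card (rc_star s n v - B) \<le> card (rc_star s n v)" by (intro card_mono) auto
    also have "\<dots> \<le> s * n" using card_rc_star[of v n s] v 0(1) by auto
    finally show "card (rc_star s n v - B) \<le> (\<Sum>j=1..m-1. b div j)" using 0 by simp
  qed (use 0 in auto)
next
  case (Suc j)
  let ?X = "rc_board s n"
  have finC: "finite C" using Suc.prems(1) finite_subset by blast
  show ?case
  proof (rule not_maker_wins_fromI)
    fix x assume x: "x \<in> ?X - (M \<union> B)"
    let ?U = "\<Union>(snd ` insert x M)"
    have finM: "finite M" using Suc.prems(8) finite_rc_board by (rule finite_subset)
    have "card ?U \<le> (\<Sum>p\<in>insert x M. card (snd p))"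
      using finM card_UN_le[of "insert x M" snd] by simp
    also have "\<dots> = (\<Sum>p\<in>insert x M. 2)"
      using Suc.prems(8) x by (intro sum.cong) (auto simp: rc_board_def)
    also have "\<dots> \<le> 2 * (card C + 1)"
      using finM Suc.prems(9) x by simp
    finally have cardU: "card ?U \<le> 2 * (card C + 1)" .
    have "snd p \<subseteq> {..<n}" if "p \<in> insert x M" for p
    proof -
      have "p \<in> ?X" using that Suc.prems(8) x by blast
      then show ?thesis by (auto simp: rc_board_def)
    qed
    then have finU: "finite ?U" by (meson UN_least finite_lessThan finite_subset)
    \<comment> \<open>All edges inside \<open>C\<close> belong to Breaker, so the free edge
      \<open>x\<close> has at most one end in \<open>C\<close>.\<close>
    define C0 where "C0 = C - snd x"
    have C0: "card C \<le> card C0 + 1"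
    proof -
      have "card (C \<inter> snd x) \<le> 1"
      proof (rule ccontr)
        assume "\<not> card (C \<inter> snd x) \<le> 1"
        then have "\<not> (\<forall>u\<in>C \<inter> snd x. \<forall>v\<in>C \<inter> snd x. u = v)"
          by (metis card_le_Suc0_iff_eq finite_Int finC One_nat_def)
        then obtain u v where uv: "u \<in> C" "u \<in> snd x" "v \<in> C" "v \<in> snd x" "u \<noteq> v" by blast
        then have "x \<in> rc_star s n u \<inter> rc_star s n v" using x by (auto simp: rc_star_def)
        then show False using Suc.prems(11)[OF uv(1,3,5)] x by blast
      qed
      moreover have "card C = card (C \<inter> snd x) + card (C - snd x)"
        using finC by (rule card_Int_Diff)
      ultimately show ?thesis by (simp add: C0_def)
    qed
    have C0': "C0 \<subseteq> C" "C0 \<inter> ?U = {}" "finite C0"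
    proof -
      have "v \<notin> snd p" if "v \<in> C" "p \<in> M" for v p
        using Suc.prems(10)[of v] that Suc.prems(8) by (auto simp: rc_star_def)
      then show "C0 \<inter> ?U = {}" by (auto simp: C0_def)
    qed (auto simp: C0_def finC)
    have cC0: "card C0 \<le> card C" using C0' finC by (simp add: card_mono)
    \<comment> \<open>Maker's edges and \<open>C0\<close> cover at most
      \<open>3 * card C + 2\<close> vertices, so two fresh ones exist.\<close>
    have "card {..<n} - card (?U \<union> C0) \<le> card ({..<n} - (?U \<union> C0))"
      using finU C0' by (intro diff_card_le_card_Diff) auto
    moreover have "card (?U \<union> C0) \<le> 2 * (card C + 1) + card C"
      using card_Un_le[of ?U C0] cardU cC0 by linarith
    ultimately have "2 \<le> card ({..<n} - (?U \<union> C0))" using Suc.prems(2,5) by simp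
    moreover have "card C + 1 - card C0 \<le> 2" using C0 by simp
    ultimately obtain N where N: "N \<subseteq> {..<n} - (?U \<union> C0)" "card N = card C + 1 - card C0"
      using obtain_subset_with_card_n[of "card C + 1 - card C0" "{..<n} - (?U \<union> C0)"] by auto
    define C' where "C' = C0 \<union> N"
    have finN: "finite N" using N finite_subset by blast
    have cC': "card C' = card C + 1"
      unfolding C'_def using N C0' finN cC0 by (subst card_Un_disjoint) auto
    have C'n: "C' \<subseteq> {..<n}" "C' \<inter> ?U = {}" using C0' N Suc.prems(1) by (auto simp: C'_def)
    \<comment> \<open>Edges inside \<open>C0\<close> are Breaker's already. Only those with an end
      among the at most two new vertices \<open>N\<close> are needed, at most
      \<open>2 * s * m\<close> of them.\<close>
    define D where "D = (\<lambda>(i, u, v). (i, {u, v})) ` ({..<s} \<times> {(u, v). u \<in> N \<and> v \<in> C' \<and> u \<noteq> v}) - B"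
    have cardD: "card D \<le> b"
    proof -
      have fC': "finite C'" using C'n finite_subset by blast
      have fin: "finite {(u, v). u \<in> N \<and> v \<in> C' \<and> u \<noteq> v}"
        by (rule finite_subset[of _ "N \<times> C'"]) (use finN fC' in auto)
      have "card D \<le> card ((\<lambda>(i, u, v). (i, {u, v})) ` ({..<s} \<times> {(u, v). u \<in> N \<and> v \<in> C' \<and> u \<noteq> v}))"
        unfolding D_def using fin by (intro card_mono) auto
      also have "\<dots> \<le> card ({..<s} \<times> {(u, v). u \<in> N \<and> v \<in> C' \<and> u \<noteq> v})"
        using fin by (intro card_image_le) auto
      also have "\<dots> \<le> card ({..<s} \<times> N \<times> C')"
        using finN fC' by (intro card_mono) auto
      also have "\<dots> = s * (card N * card C')" by (simp add: card_cartesian_product)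
      also have "\<dots> \<le> s * (2 * m)"
        using N(2) cC' Suc.prems(2) \<open>card C + 1 - card C0 \<le> 2\<close> by (intro mult_mono) auto
      finally show ?thesis using Suc.prems(6) by (simp add: mult.assoc mult.left_commute)
    qed
    have subD: "D \<subseteq> ?X - (M \<union> B) - {x}"
      using C'n N(1) by (fastforce simp: D_def)
    have wins: "\<not> maker_wins_from ?X (rc_winning_sets s n) b (insert x M) (B \<union> D')"
      if D': "D \<subseteq> D'" "D' \<subseteq> ?X - (M \<union> B) - {x}" for D'
    proof (rule Suc.IH[of C'])
      show "card (insert x M) \<le> card C'"
        using Suc.prems(9) finM cC' x by (simp)
      fix v assume "v \<in> C'"
      then show "rc_star s n v \<inter> insert x M = {}" using C'n by (auto simp: rc_star_def)
    next
      fix u v assume uv: "u \<in> C'" "v \<in> C'" "u \<noteq> v"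
      show "rc_star s n u \<inter> rc_star s n v \<subseteq> B \<union> D'"
      proof
        fix p assume p: "p \<in> rc_star s n u \<inter> rc_star s n v"
        then have "p \<in> ?X" by (simp add: rc_star_def)
        then obtain i a c where pac: "p = (i, {a, c})" "i < s" by (rule rc_board_memE)
        then have "u \<in> {a, c}" "v \<in> {a, c}" using p by (simp_all add: rc_star_def)
        then have "{a, c} = {u, v}" using uv(3) by blast
        then have i: "p = (i, {u, v})" using pac by simp
        show "p \<in> B \<union> D'"
        proof (cases "u \<in> N \<or> v \<in> N")
          case True
          then obtain y z where yz: "y \<in> N" "z \<in> C'" "y \<noteq> z" "p = (i, {y, z})"
            using uv i by (metis insert_commute)
          then have "p \<in> D \<union> B" unfolding D_def using pac(2) by (force intro: image_eqI[of _ _ "(i, y, z)"])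
          then show ?thesis using D' by blast
        next
          case False
          then have "u \<in> C" "v \<in> C" using uv C0' by (auto simp: C'_def)
          then show ?thesis using Suc.prems(11) uv(3) p by blast
        qed
      qed
    qed (use Suc.prems C'n x cC' in auto)
    show "\<exists>D \<subseteq> ?X - (M \<union> B) - {x}. card D \<le> b \<and>
      (\<forall>D'. D \<subseteq> D' \<and> D' \<subseteq> ?X - (M \<union> B) - {x} \<longrightarrow>
        \<not> maker_wins_from ?X (rc_winning_sets s n) b (insert x M) (B \<union> D'))"
      by (intro exI[of _ D] conjI allI impI subD cardD) (elim conjE, rule wins)
  next
    assume full: "?X - (M \<union> B) = {}"
    have "card (\<Union>(snd ` M)) \<le> (\<Sum>p\<in>M. card (snd p))"
      using finite_subset[OF Suc.prems(8)] by (intro card_UN_le) simp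
    also have "\<dots> = (\<Sum>p\<in>M. 2)"
      using Suc.prems(8) by (intro sum.cong) (auto simp: rc_board_def)
    also have "\<dots> < card {..<n}" using Suc.prems(2,5,9) by simp
    finally have less: "card (\<Union>(snd ` M)) < card {..<n}" .
    have "\<Union>(snd ` M) \<subseteq> {..<n}" using Suc.prems(8) by (auto elim!: rc_board_memE)
    then have "finite (\<Union>(snd ` M))" using finite_subset by blast
    then have "\<not> {..<n} \<subseteq> \<Union>(snd ` M)" using less card_mono leD by blast
    then obtain v where "v < n" "v \<notin> \<Union>(snd ` M)" by blast
    then have "rc_star s n v \<inter> M = {}" by (auto simp: rc_star_def)
    then show "\<forall>A\<in>rc_winning_sets s n. \<not> A \<subseteq> M"
      using rainbow_connected_meets_star \<open>v < n\<close> Suc.prems(4) by blast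
  qed simp
qed

lemma breaker_wins_clique_box:
  assumes "1 \<le> m" "3 * m + 5 \<le> n" "2 * s * m \<le> b" "s * n \<le> (\<Sum>j=1..m-1. b div j)"
  shows "\<not> maker_wins (rc_board s n) (rc_winning_sets s n) b"
  unfolding maker_wins_def
  by (rule breaker_wins_clique[of "{}" n m m]) (use assms in auto)

section \<open>Beck's potential\<close>

text \<open>Convexity: on the unit interval the exponential lies below its chord.\<close>

lemma two_powr_le_one_plus:
  fixes t :: real
  assumes "0 \<le> t" "t \<le> 1"
  shows "2 powr t \<le> 1 + t"
proof -
  have "convex_on UNIV (\<lambda>t::real. exp (t * ln 2))"
    by (rule f''_ge0_imp_convex[where f' = "\<lambda>t. exp (t * ln 2) * ln 2" and f'' = "\<lambda>t. exp (t * ln 2) * ln 2 * ln 2"])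
      (auto intro!: derivative_eq_intros)
  then have "convex_on UNIV (\<lambda>t::real. 2 powr t)" by (simp add: powr_def)
  then have "2 powr ((1 - t) *\<^sub>R 0 + t *\<^sub>R (1::real)) \<le> (1 - t) * 2 powr 0 + t * 2 powr (1::real)"
    using assms by (intro convex_onD) auto
  then show ?thesis by simp
qed

lemma two_powr_count_le:
  assumes "k \<le> b" "0 < b"
  shows "2 powr (real k / real b) \<le> 1 + real k / real b"
  using assms by (intro two_powr_le_one_plus) auto

text \<open>The exponent is scaled by \<open>b\<close> so that one round of Breaker at most doubles
  a weight; a set that he owns completely has weight 1.\<close>

definition beck_weight :: "nat \<Rightarrow> 'a set \<Rightarrow> 'a set \<Rightarrow> real" where
  "beck_weight b B E = 2 powr (- real (card (E - B)) / real b)"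

definition beck_potential :: "nat \<Rightarrow> 'i set \<Rightarrow> ('i \<Rightarrow> 'a set) \<Rightarrow> 'a set \<Rightarrow> 'a set \<Rightarrow> real" where
  "beck_potential b P E M B = (\<Sum>p | p \<in> P \<and> E p \<inter> M = {}. beck_weight b B (E p))"

lemma beck_weight_Un:
  assumes "finite E" "card D \<le> b" "0 < b" "finite D"
  shows "beck_weight b (B \<union> D) E \<le> beck_weight b B E * (1 + real (card ((E - B) \<inter> D)) / real b)"
proof -
  have *: "card (E - B) = card (E - (B \<union> D)) + card ((E - B) \<inter> D)"
  proof -
    have "E - (B \<union> D) = (E - B) - D" by blast
    then show ?thesis using card_Int_Diff[of "E - B" D] assms(1) by simp
  qed
  have le: "card ((E - B) \<inter> D) \<le> b"
    using assms(2,4) by (meson Int_lower2 card_mono order_trans)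
  have "beck_weight b (B \<union> D) E = beck_weight b B E * 2 powr (real (card ((E - B) \<inter> D)) / real b)"
    unfolding beck_weight_def * by (simp add: powr_add[symmetric] add_divide_distrib diff_divide_distrib)
  also have "\<dots> \<le> beck_weight b B E * (1 + real (card ((E - B) \<inter> D)) / real b)"
    using two_powr_count_le[OF le assms(3)] by (intro mult_left_mono) (auto simp: beck_weight_def)
  finally show ?thesis .
qed

text \<open>Maker takes the element \<open>x\<close> whose unhit sets have the largest total weight
  \<open>g x\<close>. This removes \<open>g x\<close>, and each of Breaker's at most
  \<open>b\<close> elements adds at most \<open>g x / b\<close>, since a weight grows at most
  linearly in the number of elements he takes from its set.\<close>

lemma beck_step:
  fixes E :: "'i \<Rightarrow> 'a set"
  assumes "finite X" "finite P" "\<And>p. p \<in> P \<Longrightarrow> E p \<subseteq> X" "0 < b"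
    and free: "X - (M \<union> B) \<noteq> {}"
  obtains x where "x \<in> X - (M \<union> B)"
    "\<And>D. D \<subseteq> X - (M \<union> B) - {x} \<Longrightarrow> card D \<le> b \<Longrightarrow>
       beck_potential b P E (insert x M) (B \<union> D) \<le> beck_potential b P E M B"
proof -
  define w where "w p = beck_weight b B (E p)" for p
  have w: "w p \<ge> 0" for p by (simp add: w_def beck_weight_def)
  define U where "U M = {p \<in> P. E p \<inter> M = {}}" for M
  have finU: "finite (U M)" for M using assms(2) by (simp add: U_def)
  define g where "g x = (\<Sum>p | p \<in> U M \<and> x \<in> E p. w p)" for x
  obtain x where x: "x \<in> X - (M \<union> B)" "\<And>y. y \<in> X - (M \<union> B) \<Longrightarrow> g y \<le> g x"
  proof -
    have "finite (X - (M \<union> B))" using assms(1) by simp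
    then have "Max (g ` (X - (M \<union> B))) \<in> g ` (X - (M \<union> B))" using free by (intro Max_in) auto
    then obtain x where x: "Max (g ` (X - (M \<union> B))) = g x" "x \<in> X - (M \<union> B)" by (rule imageE)
    show ?thesis
    proof (rule that[OF x(2)])
      fix y assume "y \<in> X - (M \<union> B)"
      then have "g y \<le> Max (g ` (X - (M \<union> B)))"
        using \<open>finite (X - (M \<union> B))\<close> by (intro Max_ge) auto
      then show "g y \<le> g x" using x(1) by simp
    qed
  qed
  show thesis
  proof (rule that[OF x(1)])
    fix D assume D: "D \<subseteq> X - (M \<union> B) - {x}" "card D \<le> b"
    have finD: "finite D" using D assms(1) finite_subset by blast
    have finE: "finite (E p)" if "p \<in> P" for p using assms(1,3) that finite_subset by blast
    let ?U' = "U (insert x M)"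
    have "beck_potential b P E (insert x M) (B \<union> D) = (\<Sum>p\<in>?U'. beck_weight b (B \<union> D) (E p))"
      by (simp add: beck_potential_def U_def)
    also have "\<dots> \<le> (\<Sum>p\<in>?U'. w p * (1 + real (card ((E p - B) \<inter> D)) / real b))"
      unfolding w_def using assms D finD
      by (intro sum_mono beck_weight_Un) (auto simp: U_def finE)
    also have "\<dots> = (\<Sum>p\<in>?U'. w p) + (\<Sum>p\<in>?U'. w p * real (card ((E p - B) \<inter> D))) / real b"
      by (simp add: algebra_simps sum.distrib sum_divide_distrib)
    also have "(\<Sum>p\<in>?U'. w p * real (card ((E p - B) \<inter> D))) \<le> (\<Sum>p\<in>?U'. \<Sum>d\<in>D. if d \<in> E p then w p else 0)"
    proof (intro sum_mono)
      fix p
      have "(E p - B) \<inter> D = {d \<in> D. d \<in> E p}" using D by auto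
      then show "w p * real (card ((E p - B) \<inter> D)) \<le> (\<Sum>d\<in>D. if d \<in> E p then w p else 0)"
        using finD by (simp add: sum.If_cases Int_def conj_commute mult.commute)
    qed
    also have "\<dots> = (\<Sum>d\<in>D. \<Sum>p\<in>?U'. if d \<in> E p then w p else 0)" by (rule sum.swap)
    also have "\<dots> \<le> (\<Sum>d\<in>D. g x)"
    proof (rule sum_mono)
      fix d assume d: "d \<in> D"
      have "(\<Sum>p\<in>?U'. if d \<in> E p then w p else 0) = (\<Sum>p | p \<in> ?U' \<and> d \<in> E p. w p)"
        using finU[of "insert x M"] by (simp add: sum.If_cases Int_def)
      also have "\<dots> \<le> g d" unfolding g_def using w assms(2) by (intro sum_mono2) (auto simp: U_def)
      also have "\<dots> \<le> g x" using x(2)[of d] d D by auto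
      finally show "(\<Sum>p\<in>?U'. if d \<in> E p then w p else 0) \<le> g x" .
    qed
    also have "\<dots> \<le> real b * g x"
      using D(2) w by (auto simp: g_def intro!: mult_right_mono sum_nonneg)
    finally have "beck_potential b P E (insert x M) (B \<union> D) \<le> (\<Sum>p\<in>?U'. w p) + g x"
      using assms(4) by (simp add: divide_right_mono field_simps)
    also have "\<dots> = (\<Sum>p\<in>U M. w p)"
    proof -
      have "U M = ?U' \<union> {p. p \<in> U M \<and> x \<in> E p}" by (auto simp: U_def)
      moreover have "sum w (?U' \<union> {p. p \<in> U M \<and> x \<in> E p}) = sum w ?U' + g x"
        unfolding g_def using assms(2) by (intro sum.union_disjoint) (auto simp: U_def)
      ultimately show ?thesis by simp
    qed
    also have "\<dots> = beck_potential b P E M B" by (simp add: beck_potential_def U_def w_def)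
    finally show "beck_potential b P E (insert x M) (B \<union> D) \<le> beck_potential b P E M B" .
  qed
qed

section \<open>Potentials for building out-edges\<close>

text \<open>Maker's choice of the vertex v of largest danger preserves this bound: a set avoiding v has at most
  the average danger of the same set with v added, for which the harmonic sum is shorter by one term.\<close>

definition avg_bounded :: "nat \<Rightarrow> real \<Rightarrow> 'v set \<Rightarrow> ('v \<Rightarrow> real) \<Rightarrow> bool" where
  "avg_bounded n \<beta> P d \<longleftrightarrow>
     (\<forall>J\<subseteq>P. J \<noteq> {} \<longrightarrow> sum d J \<le> \<beta> * real (card J) * (\<Sum>j=card J..n. 1 / real j))"

text \<open>A round raises the total over any set by at most \<open>\<beta>\<close>, and
  \<open>v\<close> loses \<open>\<beta>\<close> again. So only the sets avoiding \<open>v\<close>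
  need its maximality.\<close>

lemma avg_bounded_step:
  assumes "finite P" "card P \<le> n" "0 \<le> \<beta>" "avg_bounded n \<beta> P d" "v \<in> P"
    and max: "\<And>u. u \<in> P \<Longrightarrow> d u \<le> d v" and "P' \<subseteq> P"
    and d': "\<And>J. J \<subseteq> P' \<Longrightarrow> sum d' J \<le> sum d J + \<beta> - (if v \<in> J then \<beta> else 0)"
  shows "avg_bounded n \<beta> P' d'"
  unfolding avg_bounded_def
proof (intro allI impI)
  fix J assume J: "J \<subseteq> P'" "J \<noteq> {}"
  have finJ: "finite J" using J assms(1,7) by (meson finite_subset)
  have bd: "\<And>J. J \<subseteq> P \<Longrightarrow> J \<noteq> {} \<Longrightarrow> sum d J \<le> \<beta> * real (card J) * (\<Sum>j=card J..n. 1 / real j)"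
    using assms(4) unfolding avg_bounded_def by blast
  show "sum d' J \<le> \<beta> * real (card J) * (\<Sum>j=card J..n. 1 / real j)"
  proof (cases "v \<in> J")
    case True
    have "sum d' J \<le> sum d J" using d'[OF J(1)] True by simp
    also have "\<dots> \<le> \<beta> * real (card J) * (\<Sum>j=card J..n. 1 / real j)"
      using bd J assms(7) by blast
    finally show ?thesis .
  next
    case False
    define k where "k = card J"
    define S where "S = (\<Sum>j=Suc k..n. 1 / real j)"
    have k: "0 < k" using J finJ by (simp add: k_def card_gt_0_iff)
    have sub: "insert v J \<subseteq> P" using J assms(5,7) by auto
    have "Suc k = card (insert v J)" using False finJ by (simp add: k_def)
    also have "\<dots> \<le> n" using sub assms(1,2) card_mono order_trans by blast
    finally have kn: "Suc k \<le> n" .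
    have 1: "d v + sum d J \<le> \<beta> * real (Suc k) * S"
      using bd[OF sub] False finJ by (simp add: S_def k_def)
    \<comment> \<open>The value at \<open>v\<close> is at least the average over \<open>J\<close>,
      so leaving \<open>v\<close> out does not raise the average.\<close>
    have 2: "sum d J \<le> real k * d v"
      unfolding k_def using J assms(7) max by (intro sum_bounded_above) auto
    have "real (Suc k) * sum d J \<le> real k * (d v + sum d J)" using 2 by (simp add: algebra_simps)
    also have "\<dots> \<le> real k * (\<beta> * real (Suc k) * S)" using 1 by (intro mult_left_mono) auto
    finally have "real (Suc k) * sum d J \<le> real (Suc k) * (real k * \<beta> * S)" by (simp add: algebra_simps)
    then have "sum d J \<le> real k * \<beta> * S" by (subst (asm) mult_le_cancel_left_pos) auto
    \<comment> \<open>The additional term \<open>1 / k\<close>, multiplied by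
      \<open>\<beta> * k\<close>, pays for the increase \<open>\<beta>\<close>.\<close>
    moreover have "(\<Sum>j=k..n. 1 / real j) = 1 / real k + S"
      unfolding S_def using kn by (simp add: sum.atLeast_Suc_atMost)
    ultimately show ?thesis using d'[OF J(1)] False k unfolding k_def[symmetric]
      by (simp add: field_simps)
  qed
qed

text \<open>An out-edge p of v is encoded as the pair of its colour and its head. The weight of v is at
  least 1 once all K out-edges are chosen and T of them have their heads in W; it does not increase
  on average when the next out-edge is chosen among options of which at most a fraction 1 / l have
  their heads in W.\<close>

definition trap_weight :: "nat \<Rightarrow> nat \<Rightarrow> real \<Rightarrow> nat set \<Rightarrow> (nat \<times> nat) set \<Rightarrow> real" where
  "trap_weight K T l W S = 2 ^ K / 2 ^ card S * (l ^ card {p \<in> S. snd p \<in> W} / l ^ T)"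

text \<open>A derandomised union bound: the product estimates the chance that \<open>W\<close> traps
  all vertices of \<open>A\<close> under random choices of out-edges, and the sum runs over all
  pairs.\<close>

definition trap_potential ::
  "nat \<Rightarrow> nat \<Rightarrow> (nat set \<Rightarrow> real) \<Rightarrow> (nat set \<times> nat set) set \<Rightarrow> (nat \<Rightarrow> (nat \<times> nat) set) \<Rightarrow> real" where
  "trap_potential K T l F out = (\<Sum>(A, W)\<in>F. \<Prod>v\<in>A. trap_weight K T (l W) W (out v))"

lemma trap_weight_nonneg: "0 \<le> l \<Longrightarrow> 0 \<le> trap_weight K T l W S"
  by (simp add: trap_weight_def)

lemma trap_weight_insert:
  assumes "finite S" "p \<notin> S"
  shows "trap_weight K T l W (insert p S) = trap_weight K T l W S * ((if snd p \<in> W then l else 1) / 2)"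
proof -
  have "{q \<in> insert p S. snd q \<in> W} = (if snd p \<in> W then insert p {q \<in> S. snd q \<in> W} else {q \<in> S. snd q \<in> W})"
    by auto
  then show ?thesis using assms by (simp add: trap_weight_def mult_ac del: insert_iff)
qed

text \<open>The options with head in \<open>W\<close>, each counted \<open>l\<close> times,
  contribute at most \<open>card Av\<close>, and so do the others; the division by 2 in the weight
  absorbs the sum of the two.\<close>

lemma sum_trap_weight_insert_le:
  assumes "finite S" "finite Av" "Av \<inter> S = {}" "0 < l"
    and "l * real (card {p \<in> Av. snd p \<in> W}) \<le> real (card Av)"
  shows "(\<Sum>p\<in>Av. trap_weight K T l W (insert p S)) \<le> real (card Av) * trap_weight K T l W S"
proof -
  let ?c = "card {p \<in> Av. snd p \<in> W}"
  have "(\<Sum>p\<in>Av. trap_weight K T l W (insert p S)) =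
      trap_weight K T l W S * (\<Sum>p\<in>Av. (if snd p \<in> W then l else 1) / 2)"
    unfolding sum_distrib_left using assms(1,3)
    by (intro sum.cong refl trap_weight_insert) auto
  also have "(\<Sum>p\<in>Av. (if snd p \<in> W then l else 1) / 2) \<le> real (card Av)"
  proof -
    have "(\<Sum>p\<in>Av. (if snd p \<in> W then l else 1)) =
        l * real ?c + real (card {p \<in> Av. snd p \<notin> W})"
      using assms(2) by (simp add: sum.If_cases Int_def mult.commute)
    also have "card {p \<in> Av. snd p \<notin> W} \<le> card Av" using assms(2) by (intro card_mono) auto
    finally show ?thesis using assms(5) by (simp add: sum_divide_distrib[symmetric])
  qed
  finally show ?thesis using trap_weight_nonneg[of l K T W S] assms(4)
    by (simp add: mult.commute[of _ "trap_weight K T l W S"] mult_left_mono)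
qed

text \<open>In each product only the factor of \<open>v\<close> changes, and its mean over
  \<open>Av\<close> does not grow; hence some option does not increase the potential.\<close>

lemma trap_potential_step:
  assumes "finite F" "\<And>A W. (A, W) \<in> F \<Longrightarrow> finite A" "\<And>A W. (A, W) \<in> F \<Longrightarrow> 0 < l W"
    and "finite Av" "Av \<noteq> {}" "finite (out v)" "Av \<inter> out v = {}"
    and le: "\<And>A W. (A, W) \<in> F \<Longrightarrow> l W * real (card {p \<in> Av. snd p \<in> W}) \<le> real (card Av)"
  shows "\<exists>p\<in>Av. trap_potential K T l F (out(v := insert p (out v))) \<le> trap_potential K T l F out"
proof (rule ccontr)
  let ?\<Psi> = "trap_potential K T l F"
  assume "\<not> ?thesis"
  then have "(\<Sum>p\<in>Av. ?\<Psi> out) < (\<Sum>p\<in>Av. ?\<Psi> (out(v := insert p (out v))))"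
    using assms(4,5) by (intro sum_strict_mono) auto
  also have "\<dots> = (\<Sum>(A, W)\<in>F. \<Sum>p\<in>Av. \<Prod>u\<in>A. trap_weight K T (l W) W ((out(v := insert p (out v))) u))"
    unfolding trap_potential_def by (subst sum.swap) (simp add: case_prod_unfold)
  also have "\<dots> \<le> (\<Sum>(A, W)\<in>F. real (card Av) * (\<Prod>u\<in>A. trap_weight K T (l W) W (out u)))"
  proof (rule sum_mono, clarify)
    fix A W assume AW: "(A, W) \<in> F"
    let ?w = "\<lambda>S. trap_weight K T (l W) W S"
    show "(\<Sum>p\<in>Av. \<Prod>u\<in>A. ?w ((out(v := insert p (out v))) u)) \<le> real (card Av) * (\<Prod>u\<in>A. ?w (out u))"
    proof (cases "v \<in> A")
      case True
      have finA: "finite A" using assms(2) AW by blast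
      have "(\<Sum>p\<in>Av. \<Prod>u\<in>A. ?w ((out(v := insert p (out v))) u)) =
          (\<Sum>p\<in>Av. ?w (insert p (out v)) * (\<Prod>u\<in>A - {v}. ?w (out u)))"
        using True finA by (intro sum.cong refl) (simp add: prod.remove[of A v])
      also have "\<dots> = (\<Sum>p\<in>Av. ?w (insert p (out v))) * (\<Prod>u\<in>A - {v}. ?w (out u))"
        by (simp add: sum_distrib_right)
      also have "\<dots> \<le> (real (card Av) * ?w (out v)) * (\<Prod>u\<in>A - {v}. ?w (out u))"
        using assms(3)[OF AW] le[OF AW] assms(4,6,7)
        by (intro mult_right_mono sum_trap_weight_insert_le prod_nonneg) (auto intro!: trap_weight_nonneg)
      also have "\<dots> = real (card Av) * (\<Prod>u\<in>A. ?w (out u))"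
        using True finA by (simp add: prod.remove[of A v])
      finally show ?thesis .
    next
      case False
      then have "(\<Prod>u\<in>A. ?w ((out(v := insert p (out v))) u)) = (\<Prod>u\<in>A. ?w (out u))" for p
        by (intro prod.cong) auto
      then show ?thesis by simp
    qed
  qed
  also have "\<dots> = (\<Sum>p\<in>Av. ?\<Psi> out)"
    by (simp add: trap_potential_def sum_distrib_left case_prod_unfold)
  finally show False by simp
qed

text \<open>If all vertices of \<open>A\<close> were trapped, every factor for \<open>(A, W)\<close>
  would be at least 1, so this summand alone would bring the potential to 1.\<close>

lemma trap_potential_small:
  assumes "trap_potential K T l F out < 1" "finite F" "\<And>A W. (A, W) \<in> F \<Longrightarrow> 1 \<le> l W"
    and "(A, W) \<in> F" "\<And>v. v \<in> A \<Longrightarrow> card (out v) = K"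
  shows "\<exists>v\<in>A. card {p \<in> out v. snd p \<in> W} < T"
proof (rule ccontr)
  assume "\<not> ?thesis"
  then have T: "T \<le> card {p \<in> out v. snd p \<in> W}" if "v \<in> A" for v using that by force
  have "1 \<le> (\<Prod>v\<in>A. trap_weight K T (l W) W (out v))"
  proof (rule prod_ge_1)
    fix v assume v: "v \<in> A"
    have "l W ^ T \<le> l W ^ card {p \<in> out v. snd p \<in> W}"
      using assms(3)[OF assms(4)] T[OF v] by (rule power_increasing[rotated])
    then show "1 \<le> trap_weight K T (l W) W (out v)"
      using assms(3)[OF assms(4)] assms(5)[OF v] by (simp add: trap_weight_def)
  qed
  also have "\<dots> \<le> trap_potential K T l F out"
  proof -
    have nn: "0 \<le> (\<Prod>v\<in>A. trap_weight K T (l W) W (out v))" if "(A, W) \<in> F" for A W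
    proof (rule prod_nonneg, rule trap_weight_nonneg)
      show "0 \<le> l W" using assms(3)[OF that] by simp
    qed
    show ?thesis unfolding trap_potential_def
      using member_le_sum[OF assms(4), of "\<lambda>(A, W). \<Prod>v\<in>A. trap_weight K T (l W) W (out v)"] nn assms(2)
      by fastforce
  qed
  finally show False using assms(1) by simp
qed

section \<open>Union bound for the initial trap potential\<close>

lemma binomial_le_exp_power:
  assumes "0 < w"
  shows "real (n choose w) \<le> (exp 1 * real n / real w) ^ w"
proof (cases "n = 0")
  case False
  \<comment> \<open>The single term \<open>k = w\<close> in the expansion of
    \<open>(1 + z) ^ n\<close>, which is at most \<open>exp w\<close> for this \<open>z\<close>,
    gives the bound.\<close>
  define z where "z = real w / real n"
  have z: "0 < z" using assms False by (simp add: z_def)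
  have "real (n choose w) * z ^ w \<le> (1 + z) ^ n"
  proof (cases "w \<le> n")
    case True
    have "real (n choose w) * z ^ w \<le> (\<Sum>k\<le>n. real (n choose k) * z ^ k)"
      using True z by (intro member_le_sum) auto
    also have "\<dots> = (1 + z) ^ n" using binomial_ring[of z 1 n] by (simp add: add.commute)
    finally show ?thesis .
  qed (use z in \<open>simp add: binomial_eq_0\<close>)
  also have "\<dots> \<le> exp z ^ n" using z by (intro power_mono) (auto simp: exp_ge_add_one_self)
  also have "\<dots> = exp 1 ^ w" using False by (simp add: exp_of_nat_mult[symmetric] z_def)
  finally show ?thesis using z assms False
    by (simp add: z_def power_divide power_mult_distrib field_simps)
qed (use assms in \<open>simp add: binomial_eq_0\<close>)

text \<open>\<open>W\<close> has exactly \<open>Q * k\<close> elements; smaller sets of heads are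
  padded to this size.\<close>

definition trap_family :: "nat \<Rightarrow> nat \<Rightarrow> nat \<Rightarrow> (nat set \<times> nat set) set" where
  "trap_family n Q a = (\<Union>k\<in>{1..a}. {A. A \<subseteq> {..<n} \<and> card A = k} \<times> {W. W \<subseteq> {..<n} \<and> card W = Q * k})"

lemma finite_trap_family: "finite (trap_family n Q a)"
  by (auto simp: trap_family_def)

lemma sum_half_powers_less: "(\<Sum>k=1..a. (1/2) ^ k) < (1::real)"
proof -
  have "(\<Sum>k=1..a. (1/2) ^ k) = 1 - (1/2::real) ^ a" by (induction a) auto
  then show ?thesis by simp
qed

text \<open>With \<open>t = n / (Q * k)\<close>, the number of pairs for \<open>k\<close> is at most
  the \<open>k\<close>-th power of \<open>t ^ (3 * Q + 2)\<close>. By the bound on \<open>a\<close>,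
  the square of \<open>4 / (\<eta> * t)\<close> is at most \<open>1 / t\<close>, so a pair has
  weight at most the \<open>k\<close>-th power of \<open>1 / t ^ (4 * Q)\<close>. As
  \<open>Q\<close> is at least 3, the terms for \<open>k\<close> sum to at most
  \<open>(1/2) ^ k\<close>.\<close>

lemma trap_potential_initial:
  fixes \<eta> :: real
  assumes "3 \<le> Q" "0 < \<eta>" "\<eta> \<le> 1" "16 * real Q * real a \<le> \<eta>\<^sup>2 * real n"
  shows "trap_potential (16 * Q) (8 * Q) (\<lambda>W. \<eta> * real n / real (card W)) (trap_family n Q a) (\<lambda>_. {}) < 1"
proof -
  let ?T = "8 * Q"
  \<comment> \<open>For an empty out-set the factor \<open>2 ^ (16 * Q)\<close> is
    \<open>4 ^ (8 * Q)\<close>.\<close>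
  have wt: "trap_weight (16 * Q) ?T l W {} = (4 / l) ^ ?T" for l W
    by (simp add: trap_weight_def power_divide power_mult)
  have "trap_potential (16 * Q) ?T (\<lambda>W. \<eta> * real n / real (card W)) (trap_family n Q a) (\<lambda>_. {}) =
      (\<Sum>(A, W)\<in>trap_family n Q a. ((4 * real (card W) / (\<eta> * real n)) ^ ?T) ^ card A)"
    by (simp add: trap_potential_def wt)
  also have "\<dots> = (\<Sum>k\<in>{1..a}. \<Sum>(A, W)\<in>{A. A \<subseteq> {..<n} \<and> card A = k} \<times> {W. W \<subseteq> {..<n} \<and> card W = Q * k}.
       ((4 * real (card W) / (\<eta> * real n)) ^ ?T) ^ card A)"
    unfolding trap_family_def by (rule sum.UNION_disjoint) auto
  also have "\<dots> = (\<Sum>k\<in>{1..a}. real (n choose k) * real (n choose (Q * k)) * ((4 * real (Q * k) / (\<eta> * real n)) ^ ?T) ^ k)"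
  proof (rule sum.cong)
    fix k
    have "(\<Sum>(A, W)\<in>{A. A \<subseteq> {..<n} \<and> card A = k} \<times> {W. W \<subseteq> {..<n} \<and> card W = Q * k}.
        ((4 * real (card W) / (\<eta> * real n)) ^ ?T) ^ card A) =
      (\<Sum>(A, W)\<in>{A. A \<subseteq> {..<n} \<and> card A = k} \<times> {W. W \<subseteq> {..<n} \<and> card W = Q * k}.
        ((4 * real (Q * k) / (\<eta> * real n)) ^ ?T) ^ k)"
      by (rule sum.cong) auto
    then show "(\<Sum>(A, W)\<in>{A. A \<subseteq> {..<n} \<and> card A = k} \<times> {W. W \<subseteq> {..<n} \<and> card W = Q * k}.
        ((4 * real (card W) / (\<eta> * real n)) ^ ?T) ^ card A) =
        real (n choose k) * real (n choose (Q * k)) * ((4 * real (Q * k) / (\<eta> * real n)) ^ ?T) ^ k"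
      by (simp add: card_cartesian_product n_subsets case_prod_unfold)
  qed simp
  also have "\<dots> \<le> (\<Sum>k\<in>{1..a}. (1/2) ^ k)"
  proof (rule sum_mono)
    fix k assume k: "k \<in> {1..a}"
    define t where "t = real n / real (Q * k)"
    have Qk: "0 < Q * k" using k assms(1) by simp
    have "16 * real (Q * k) \<le> 16 * real Q * real a" using k by (simp add: mult_left_mono)
    also note assms(4)
    finally have Qkn: "16 * real (Q * k) \<le> \<eta>\<^sup>2 * real n" .
    have t1: "16 / \<eta>\<^sup>2 \<le> t"
      unfolding t_def using Qkn Qk assms(2) by (simp add: field_simps)
    have "\<eta>\<^sup>2 \<le> 1" using assms(2,3) by (simp add: power_le_one)
    then have t16: "16 \<le> t" using t1 assms(2)
      by (smt (verit) divide_le_eq_1_pos le_divide_eq zero_less_power mult_left_le)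
    have et: "exp 1 * t \<le> t\<^sup>2"
      using exp_le t16 by (simp add: power2_eq_square mult_right_mono)
    define r where "r = 4 / (\<eta> * t)"
    have r2: "r\<^sup>2 \<le> 1 / t"
      using t1 t16 assms(2) by (simp add: r_def power_divide power_mult_distrib field_simps power2_eq_square)
    have Qt: "real Q \<le> t ^ Q"
    proof -
      have "real Q \<le> 2 ^ Q" using of_nat_less_two_power[of Q] by (metis less_imp_le)
      also have "\<dots> \<le> t ^ Q" using t16 by (intro power_mono) auto
      finally show ?thesis .
    qed
    have "(exp 1 * t * real Q) * ((exp 1 * t) ^ Q * r ^ ?T) \<le> (t\<^sup>2 * t ^ Q) * ((t\<^sup>2) ^ Q * (1 / t) ^ (4 * Q))"
    proof (intro mult_mono et Qt)
      show "(exp 1 * t) ^ Q \<le> (t\<^sup>2) ^ Q" using et t16 by (intro power_mono) auto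
      have "r ^ ?T = (r\<^sup>2) ^ (4 * Q)" by (simp add: power_mult[symmetric])
      also have "\<dots> \<le> (1 / t) ^ (4 * Q)" using r2 by (intro power_mono) auto
      finally show "r ^ ?T \<le> (1 / t) ^ (4 * Q)" .
      show "0 \<le> (exp 1 * t) ^ Q * r ^ ?T"
        using t16 assms(2) by (simp add: r_def)
      show "0 \<le> r ^ ?T" using t16 assms(2) by (simp add: r_def)
    qed (use t16 in auto)
    also have "\<dots> = t ^ (3 * Q + 2) / t ^ (4 * Q)"
      by (simp add: power_divide power_add[symmetric] power_mult[symmetric] algebra_simps)
    also have "\<dots> \<le> t ^ (4 * Q - 1) / t ^ (4 * Q)"
      using t16 assms(1) by (intro divide_right_mono power_increasing) auto
    also have "\<dots> = 1 / t"
      using t16 assms(1) by (simp add: power_diff)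
    also have "\<dots> \<le> 1 / 2" using t16 by simp
    finally have base: "(exp 1 * t * real Q) * ((exp 1 * t) ^ Q * r ^ ?T) \<le> 1 / 2" .
    have "real (n choose k) * real (n choose (Q * k)) * ((4 * real (Q * k) / (\<eta> * real n)) ^ ?T) ^ k \<le>
       (exp 1 * real n / real k) ^ k * (exp 1 * real n / real (Q * k)) ^ (Q * k) * ((4 * real (Q * k) / (\<eta> * real n)) ^ ?T) ^ k"
      using Qk k assms(2) by (intro mult_right_mono mult_mono binomial_le_exp_power) auto
    also have "\<dots> = (exp 1 * t * real Q) ^ k * ((exp 1 * t) ^ Q) ^ k * (r ^ ?T) ^ k"
    proof -
      have "exp 1 * real n / real k = exp 1 * t * real Q" using Qk by (simp add: t_def)
      moreover have "exp 1 * real n / real (Q * k) = exp 1 * t" by (simp add: t_def)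
      moreover have "4 * real (Q * k) / (\<eta> * real n) = r" by (simp add: r_def t_def)
      ultimately show ?thesis by (simp only: power_mult)
    qed
    also have "\<dots> = ((exp 1 * t * real Q) * ((exp 1 * t) ^ Q * r ^ ?T)) ^ k"
      by (simp only: power_mult_distrib mult.assoc)
    also have "\<dots> \<le> (1/2) ^ k"
      using base t16 assms(2) by (intro power_mono) (auto simp: r_def)
    finally show "real (n choose k) * real (n choose (Q * k)) * ((4 * real (Q * k) / (\<eta> * real n)) ^ ?T) ^ k \<le> (1/2) ^ k" .
  qed
  also have "\<dots> < 1" by (rule sum_half_powers_less)
  finally show ?thesis .
qed

section \<open>Rainbow walks and expansion\<close>

text \<open>Only colours are recorded and vertices may repeat, which makes walks easy to concatenate
  and reverse.\<close>

inductive colour_walk :: "(nat \<times> nat set) set \<Rightarrow> nat \<Rightarrow> nat list \<Rightarrow> nat \<Rightarrow> bool" for M where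
  Nil: "colour_walk M x [] x"
| Cons: "(c, {x, z}) \<in> M \<Longrightarrow> colour_walk M z cs y \<Longrightarrow> colour_walk M x (c # cs) y"

lemma colour_walk_append:
  "colour_walk M x cs y \<Longrightarrow> colour_walk M y ds z \<Longrightarrow> colour_walk M x (cs @ ds) z"
  by (induction rule: colour_walk.induct) (auto intro: colour_walk.intros)

lemma colour_walk_single: "(c, {x, y}) \<in> M \<Longrightarrow> colour_walk M x [c] y"
  by (auto intro: colour_walk.intros)

lemma colour_walk_rev: "colour_walk M x cs y \<Longrightarrow> colour_walk M y (rev cs) x"
proof (induction rule: colour_walk.induct)
  case (Cons c x z cs y)
  then show ?case using colour_walk_append[OF Cons.IH colour_walk_single[of c z x M]]
    by (simp add: insert_commute)
qed (auto intro: colour_walk.intros)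

lemma colour_walk_mono: "colour_walk M x cs y \<Longrightarrow> M \<subseteq> M' \<Longrightarrow> colour_walk M' x cs y"
  by (induction rule: colour_walk.induct) (auto intro: colour_walk.intros)

text \<open>Edges are prepended one by one. If the new vertex already occurs on the path, the path
  is cut to its part from there on, whose colours are still distinct.\<close>

lemma rainbow_path_of_colour_walk:
  assumes "colour_walk M x cs y" "distinct cs"
  shows "rainbow_path M x y"
proof -
  have "\<exists>vs ds. length vs = length ds + 1 \<and> hd vs = x \<and> last vs = y \<and> distinct vs \<and> distinct ds \<and>
      set ds \<subseteq> set cs \<and> (\<forall>k < length ds. (ds ! k, {vs ! k, vs ! Suc k}) \<in> M)"
    using assms
  proof (induction rule: colour_walk.induct)
    case (Nil x)
    show ?case by (rule exI[of _ "[x]"], rule exI[of _ "[]"]) simp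
  next
    case (Cons c x z cs y)
    then obtain vs ds where vs: "length vs = length ds + 1" "hd vs = z" "last vs = y" "distinct vs"
      "distinct ds" "set ds \<subseteq> set cs" "\<And>k. k < length ds \<Longrightarrow> (ds ! k, {vs ! k, vs ! Suc k}) \<in> M"
      by auto
    have ne: "vs \<noteq> []" using vs(1) by auto
    show ?case
    proof (cases "x \<in> set vs")
      case True
      then obtain j where j: "j < length vs" "vs ! j = x" by (auto simp: in_set_conv_nth)
      show ?thesis
      proof (intro exI conjI)
        show "length (drop j vs) = length (drop j ds) + 1" using j vs(1) by auto
        show "hd (drop j vs) = x" using j by (simp add: hd_drop_conv_nth)
        show "last (drop j vs) = y" using j vs(3) by simp
        show "set (drop j ds) \<subseteq> set (c # cs)" using vs(6) set_drop_subset[of j ds] by auto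
        show "\<forall>k<length (drop j ds). (drop j ds ! k, {drop j vs ! k, drop j vs ! Suc k}) \<in> M"
        proof (intro allI impI)
          fix k assume "k < length (drop j ds)"
          then show "(drop j ds ! k, {drop j vs ! k, drop j vs ! Suc k}) \<in> M"
            using vs(7)[of "j + k"] vs(1) j by simp
        qed
      qed (use vs in auto)
    next
      case False
      show ?thesis
      proof (intro exI conjI)
        show "length (x # vs) = length (c # ds) + 1" using vs(1) by simp
        show "last (x # vs) = y" using vs(3) ne by simp
        show "distinct (x # vs)" using False vs(4) by simp
        show "distinct (c # ds)" using vs(5,6) Cons.prems by auto
        show "set (c # ds) \<subseteq> set (c # cs)" using vs(6) by auto
        show "\<forall>k<length (c # ds). ((c # ds) ! k, {(x # vs) ! k, (x # vs) ! Suc k}) \<in> M"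
        proof (intro allI impI)
          fix k assume "k < length (c # ds)"
          then show "((c # ds) ! k, {(x # vs) ! k, (x # vs) ! Suc k}) \<in> M"
            using vs(2,7) Cons.hyps(1) ne by (cases k) (auto simp: hd_conv_nth)
        qed
      qed simp
    qed
  qed
  then show ?thesis unfolding rainbow_path_def by blast
qed

text \<open>Colours below s0 are the reserved ones: any such edge in the following set completes a
  rainbow walk from x to y.\<close>

definition linkers :: "nat \<Rightarrow> nat \<Rightarrow> (nat \<times> nat set) set \<Rightarrow> nat \<Rightarrow> nat \<Rightarrow> (nat \<times> nat set) set" where
  "linkers s0 n M x y = {(i, {u, w}) | i u w. i < s0 \<and> u < n \<and> w < n \<and> u \<noteq> w \<and>
     (\<exists>P R. colour_walk M x P u \<and> colour_walk M y R w \<and> distinct (P @ R) \<and> set (P @ R) \<subseteq> {s0..})}"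

text \<open>The linker's colour is below \<open>s0\<close>, so it differs from all colours of the
  two walks. The walks live in \<open>M\<close>; the linker may be claimed later, in
  \<open>M'\<close>.\<close>

lemma rainbow_path_of_linker:
  assumes "p \<in> linkers s0 n M x y" "p \<in> M'" "M \<subseteq> M'"
  shows "rainbow_path M' x y"
proof -
  obtain i u w P R where *: "p = (i, {u, w})" "i < s0" "colour_walk M x P u" "colour_walk M y R w"
      "distinct (P @ R)" "set (P @ R) \<subseteq> {s0..}"
    using assms(1) unfolding linkers_def by blast
  have "colour_walk M' u [i] w" using * assms(2) by (auto intro: colour_walk_single)
  moreover have "colour_walk M' w (rev R) y" using * assms(3) by (auto intro: colour_walk_rev colour_walk_mono)
  ultimately have "colour_walk M' x (P @ [i] @ rev R) y"
    using colour_walk_mono[OF *(3) assms(3)] by (blast intro: colour_walk_append)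
  moreover have "distinct (P @ [i] @ rev R)" using *(2,5,6) by auto
  ultimately show ?thesis by (rule rainbow_path_of_colour_walk)
qed

lemma card_fst_mem_le:
  assumes "inj_on fst S" "finite Y"
  shows "card {p \<in> S. fst p \<in> Y} \<le> card Y"
  by (rule card_inj_on_le[of fst]) (use assms in \<open>auto intro: inj_on_subset\<close>)

text \<open>Maker's graph once all out-sets are complete. By \<open>Qpow\<close>, growth by the
  factor \<open>Q\<close> reaches size \<open>a\<close> within \<open>3 * Q\<close> steps.\<close>

locale expanding_out_sets =
  fixes n Q a s0 :: nat and M :: "(nat \<times> nat set) set" and out :: "nat \<Rightarrow> (nat \<times> nat) set"
  assumes card_out: "v < n \<Longrightarrow> card (out v) = 16 * Q"
    and inj_out: "v < n \<Longrightarrow> inj_on fst (out v)"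
    and out_mem: "v < n \<Longrightarrow> (c, h) \<in> out v \<Longrightarrow> s0 \<le> c \<and> h < n \<and> (c, {v, h}) \<in> M"
    and no_trap: "(A, W) \<in> trap_family n Q a \<Longrightarrow> \<exists>v\<in>A. card {p \<in> out v. snd p \<in> W} < 8 * Q"
    and Q1: "1 \<le> Q" and a1: "1 \<le> a" and Qa: "Q * a \<le> n" and Qpow: "a \<le> Q ^ (3 * Q)"
begin

definition reach :: "nat \<Rightarrow> nat set \<Rightarrow> nat \<Rightarrow> nat set" where
  "reach x Z i = {u. u < n \<and> (\<exists>cs. colour_walk M x cs u \<and> distinct cs \<and> set cs \<subseteq> {s0..} - Z \<and> length cs = i)}"

lemma finite_reach: "finite (reach x Z i)"
  by (simp add: reach_def)

text \<open>Otherwise the next layer is padded to a set \<open>W\<close> of size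
  \<open>Q * card A\<close>, which fails to trap some \<open>v\<close> in \<open>A\<close>. The walk
  to \<open>v\<close> and \<open>Z\<close> together forbid at most \<open>6 * Q + 1\<close> colours,
  so at least \<open>10 * Q - 1\<close> out-edges of \<open>v\<close> extend the walk into
  \<open>W\<close>, but fewer than \<open>8 * Q\<close> may lead there.\<close>

lemma reach_expands:
  assumes A: "A \<subseteq> reach x Z i" "1 \<le> card A" "card A \<le> a" and i: "i \<le> 3 * Q"
    and Z: "finite Z" "card Z \<le> 3 * Q + 1"
  shows "Q * card A < card (reach x Z (Suc i))"
proof (rule ccontr)
  assume "\<not> ?thesis"
  then have "card (reach x Z (Suc i)) \<le> Q * card A" by simp
  moreover have "Q * card A \<le> card {..<n}" using A(3) Qa by (metis card_lessThan le_trans mult_le_mono2)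
  moreover have "reach x Z (Suc i) \<subseteq> {..<n}" by (auto simp: reach_def)
  ultimately obtain W where W: "reach x Z (Suc i) \<subseteq> W" "W \<subseteq> {..<n}" "card W = Q * card A"
    using exists_subset_between[of "reach x Z (Suc i)" "Q * card A" "{..<n}"] by auto
  have "(A, W) \<in> trap_family n Q a"
    using A W unfolding trap_family_def by (auto simp: reach_def)
  then obtain v where v: "v \<in> A" "card {p \<in> out v. snd p \<in> W} < 8 * Q" using no_trap by blast
  then have vn: "v < n" using A(1) by (auto simp: reach_def)
  have finv: "finite (out v)" using card_out[OF vn] Q1 by (intro card_ge_0_finite) simp
  obtain cs where cs: "colour_walk M x cs v" "distinct cs" "set cs \<subseteq> {s0..} - Z" "length cs = i"
    using A(1) v(1) by (auto simp: reach_def)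
  let ?Y = "Z \<union> set cs"
  have "card ?Y \<le> 6 * Q + 1"
    using card_Un_le[of Z "set cs"] card_length[of cs] Z(2) cs(4) i by linarith
  then have "card {p \<in> out v. fst p \<in> ?Y} \<le> 6 * Q + 1"
    using card_fst_mem_le[OF inj_out[OF vn], of ?Y] Z(1) by simp
  moreover have "card (out v) = card {p \<in> out v. fst p \<in> ?Y} + card {p \<in> out v. fst p \<notin> ?Y}"
  proof -
    have "out v = {p \<in> out v. fst p \<in> ?Y} \<union> {p \<in> out v. fst p \<notin> ?Y}" by blast
    also have "card \<dots> = card {p \<in> out v. fst p \<in> ?Y} + card {p \<in> out v. fst p \<notin> ?Y}"
      using finv by (intro card_Un_disjoint) auto
    finally show ?thesis .
  qed
  moreover have "{p \<in> out v. fst p \<notin> ?Y} \<subseteq> {p \<in> out v. snd p \<in> W}"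
  proof
    fix p assume "p \<in> {p \<in> out v. fst p \<notin> ?Y}"
    moreover obtain c h where ch: "p = (c, h)" by fastforce
    ultimately have p: "(c, h) \<in> out v" "fst (c, h) \<notin> ?Y" by auto
    then have o: "s0 \<le> c" "h < n" "(c, {v, h}) \<in> M" using out_mem[OF vn] by auto
    have "colour_walk M x (cs @ [c]) h"
      using cs(1) o(3) by (intro colour_walk_append colour_walk_single)
    moreover have "distinct (cs @ [c])" "set (cs @ [c]) \<subseteq> {s0..} - Z" "length (cs @ [c]) = Suc i"
      using cs p o by auto
    ultimately have "h \<in> reach x Z (Suc i)" using o(2) unfolding reach_def by blast
    then show "p \<in> {p \<in> out v. snd p \<in> W}" using W(1) p(1) ch by auto
  qed
  then have "card {p \<in> out v. fst p \<notin> ?Y} \<le> card {p \<in> out v. snd p \<in> W}"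
    using finv by (intro card_mono) auto
  ultimately show False using v(2) card_out[OF vn] Q1 by linarith
qed

lemma reach_large:
  assumes "x < n" "finite Z" "card Z \<le> 3 * Q + 1"
  shows "Q * a \<le> card (reach x Z (Suc (3 * Q)))"
proof -
  \<comment> \<open>Expansion is known only for sets of at most \<open>a\<close> vertices, hence the
    truncation. One last step then gains another factor \<open>Q\<close>.\<close>
  have grow: "min (Q ^ i) a \<le> card (reach x Z i)" if "i \<le> 3 * Q" for i
    using that
  proof (induction i)
    case 0
    have "x \<in> reach x Z 0" using assms(1) by (auto simp: reach_def intro: colour_walk.Nil)
    then have "0 < card (reach x Z 0)" using finite_reach card_gt_0_iff by blast
    then show ?case by simp
  next
    case (Suc i)
    then have "min (Q ^ i) a \<le> card (reach x Z i)" by simp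
    then obtain A where A: "A \<subseteq> reach x Z i" "card A = min (Q ^ i) a"
      using obtain_subset_with_card_n by metis
    have "Q * card A < card (reach x Z (Suc i))"
      using A Q1 a1 Suc.prems assms by (intro reach_expands) auto
    moreover have "min (Q ^ Suc i) a \<le> Q * card A"
    proof -
      have "a \<le> Q * a" using Q1 by simp
      then show ?thesis unfolding A(2) nat_mult_min_right by (intro min.mono) auto
    qed
    ultimately show ?case by linarith
  qed
  have "a \<le> card (reach x Z (3 * Q))" using grow[of "3 * Q"] Qpow by simp
  then obtain A where A: "A \<subseteq> reach x Z (3 * Q)" "card A = a"
    using obtain_subset_with_card_n by metis
  then show ?thesis using reach_expands[of A x Z "3 * Q"] a1 assms by auto
qed

text \<open>Counts pairs of a vertex \<open>u\<close> reached from \<open>x\<close> and a vertex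
  \<open>w\<close> reached from \<open>y\<close>. A walk to \<open>u\<close> has
  \<open>3 * Q + 1\<close> colours, as many as \<open>reach_large\<close> allows to forbid. The
  factor 2 is for the two orders of a pair.\<close>

lemma card_linkers_ge:
  assumes "x < n" "y < n"
  shows "s0 * (Q * a * (Q * a - 1)) \<le> 2 * card (linkers s0 n M x y)"
proof -
  let ?m = "Q * a"
  let ?U = "reach x {} (Suc (3 * Q))"
  have "\<forall>u\<in>?U. \<exists>cs. colour_walk M x cs u \<and> distinct cs \<and> set cs \<subseteq> {s0..} \<and> length cs = Suc (3 * Q)"
    by (auto simp: reach_def)
  then obtain P where P: "\<And>u. u \<in> ?U \<Longrightarrow> colour_walk M x (P u) u \<and> distinct (P u) \<and>
      set (P u) \<subseteq> {s0..} \<and> length (P u) = Suc (3 * Q)" by metis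
  \<comment> \<open>Each endpoint u has its own forbidden colour set, that of a walk from x to u; this makes the
    walks from y colour-disjoint from it.\<close>
  let ?W = "\<lambda>u. reach y (set (P u)) (Suc (3 * Q)) - {u}"
  have U: "?m \<le> card ?U" using reach_large[OF assms(1), of "{}"] by simp
  have W: "?m - 1 \<le> card (?W u)" if "u \<in> ?U" for u
  proof -
    have "card (set (P u)) \<le> 3 * Q + 1" using P[OF that] card_length[of "P u"] by simp
    then have "?m \<le> card (reach y (set (P u)) (Suc (3 * Q)))"
      using reach_large[OF assms(2)] by simp
    moreover have "card (reach y (set (P u)) (Suc (3 * Q))) - 1 \<le> card (?W u)"
      using card_Diff_singleton_if[of "reach y (set (P u)) (Suc (3 * Q))" u] by auto
    ultimately show ?thesis by linarith
  qed
  let ?T = "Sigma ?U ?W"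
  have finT: "finite ?T" by (auto simp: finite_reach)
  have "?m * (?m - 1) \<le> (\<Sum>u\<in>?U. card (?W u))"
  proof -
    have "?m * (?m - 1) \<le> card ?U * (?m - 1)" using U by (rule mult_le_mono1)
    also have "\<dots> = (\<Sum>u\<in>?U. ?m - 1)" by simp
    also have "\<dots> \<le> (\<Sum>u\<in>?U. card (?W u))" using W by (intro sum_mono)
    finally show ?thesis .
  qed
  also have "\<dots> = card ?T" by (simp add: finite_reach)
  finally have cardT: "?m * (?m - 1) \<le> card ?T" .
  let ?f = "\<lambda>(i::nat, u::nat, w::nat). (i, {u, w})"
  \<comment> \<open>On either half \<open>?f\<close> is injective, and the halves add up to
    \<open>?T\<close>.\<close>
  let ?T1 = "{(u, w) \<in> ?T. u < w}" and ?T2 = "{(u, w) \<in> ?T. w < u}"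
  have finL: "finite (?f ` ({..<s0} \<times> ?T))" using finT by simp
  have sub: "?f ` ({..<s0} \<times> ?T) \<subseteq> linkers s0 n M x y"
  proof
    fix p assume "p \<in> ?f ` ({..<s0} \<times> ?T)"
    then obtain i u w where p: "p = (i, {u, w})" and
      *: "i < s0" "u \<in> ?U" "w \<in> reach y (set (P u)) (Suc (3 * Q))" "u \<noteq> w" by auto
    then obtain R where R: "colour_walk M y R w" "distinct R" "set R \<subseteq> {s0..} - set (P u)"
      by (auto simp: reach_def)
    have "distinct (P u @ R)" "set (P u @ R) \<subseteq> {s0..}" using P[OF *(2)] R by auto
    moreover have "u < n" "w < n" using *(2,3) by (auto simp: reach_def)
    ultimately show "p \<in> linkers s0 n M x y"
      unfolding linkers_def p using P[OF *(2)] R(1) * by blast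
  qed
  have "finite (linkers s0 n M x y)"
    by (rule finite_subset[of _ "{..<s0} \<times> Pow {..<n}"]) (auto simp: linkers_def)
  then have card_sub: "card (?f ` ({..<s0} \<times> T')) \<le> card (linkers s0 n M x y)" if "T' \<subseteq> ?T" for T'
    using that by (intro card_mono order_trans[OF image_mono sub]) auto
  have "inj_on ?f ({..<s0} \<times> ?T1)" "inj_on ?f ({..<s0} \<times> ?T2)"
    by (auto simp: inj_on_def doubleton_eq_iff)
  then have "card (?f ` ({..<s0} \<times> ?T1)) = s0 * card ?T1" "card (?f ` ({..<s0} \<times> ?T2)) = s0 * card ?T2"
    by (simp_all add: card_image card_cartesian_product)
  then have "s0 * card ?T1 \<le> card (linkers s0 n M x y)" "s0 * card ?T2 \<le> card (linkers s0 n M x y)"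
    using card_sub[of ?T1] card_sub[of ?T2] by auto
  moreover have "card ?T = card ?T1 + card ?T2"
  proof -
    have T: "?T = ?T1 \<union> ?T2" by auto
    have "card (?T1 \<union> ?T2) = card ?T1 + card ?T2"
      by (intro card_Un_disjoint finite_subset[OF _ finT]) auto
    with arg_cong[OF T, of card] show ?thesis by (rule trans)
  qed
  ultimately have "s0 * card ?T \<le> 2 * card (linkers s0 n M x y)" by (simp add: distrib_left)
  then show ?thesis using mult_le_mono2[OF cardT, of s0] by linarith
qed

end

section \<open>Maker's strategy\<close>

text \<open>Double counting: an edge lies in the stars of its two ends only.\<close>

lemma sum_card_rc_star_le:
  assumes "finite J" "D \<subseteq> rc_board s n"
  shows "(\<Sum>v\<in>J. card (rc_star s n v \<inter> D)) \<le> 2 * card D"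
proof -
  have finD: "finite D" using assms(2) finite_rc_board finite_subset by blast
  have "(\<Sum>v\<in>J. card (rc_star s n v \<inter> D)) = (\<Sum>v\<in>J. \<Sum>p\<in>D. if v \<in> snd p then 1 else 0)"
  proof (rule sum.cong)
    fix v
    have "rc_star s n v \<inter> D = {p \<in> D. v \<in> snd p}" using assms(2) by (auto simp: rc_star_def)
    then show "card (rc_star s n v \<inter> D) = (\<Sum>p\<in>D. if v \<in> snd p then 1 else 0)"
      using finD by (simp add: sum.If_cases Int_def)
  qed simp
  also have "\<dots> = (\<Sum>p\<in>D. \<Sum>v\<in>J. if v \<in> snd p then 1 else 0)" by (rule sum.swap)
  also have "\<dots> \<le> (\<Sum>p\<in>D. 2)"
  proof (rule sum_mono)
    fix p assume "p \<in> D"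
    then have p: "card (snd p) = 2" using assms(2) by (auto simp: rc_board_def)
    then have "finite (snd p)" by (intro card_ge_0_finite) simp
    then have "card {v \<in> J. v \<in> snd p} \<le> card (snd p)" by (intro card_mono) auto
    then show "(\<Sum>v\<in>J. if v \<in> snd p then 1 else 0) \<le> (2::nat)"
      using p assms(1) by (simp add: sum.If_cases Int_def)
  qed
  finally show ?thesis by simp
qed

lemma linkers_subset_board: "s0 \<le> s \<Longrightarrow> linkers s0 n M x y \<subseteq> rc_board s n"
  by (auto simp: linkers_def)

text \<open>\<open>\<eta>\<close> bounds from below the share of edges at an unfinished vertex that
  stay available. \<open>degree\<close> subtracts Breaker's edges at the vertex and, in its last
  term, Maker's edges and those of colours already used there. In \<open>beck\<close>,
  \<open>n\<^sup>2\<close> bounds the number of pairs and \<open>16 * b * Q * n\<close> the edges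
  that Breaker takes in the first stage; \<open>max b 1\<close> avoids a division by zero.\<close>

locale maker_parameters =
  fixes n s s0 Q a b :: nat and \<eta> :: real
  assumes s0: "s0 \<le> s" and Q3: "3 \<le> Q" and a1: "1 \<le> a" and Qpow: "a \<le> Q ^ (3 * Q)"
    and \<eta>: "0 < \<eta>" "\<eta> \<le> 1" and Qa: "16 * real Q * real a \<le> \<eta>\<^sup>2 * real n"
    and degree: "\<eta> * real s * real n \<le> real (s - s0) * real (n - 1)
        - 2 * real b * (harm n + 16 * real Q) - 32 * real Q * real n"
    and beck: "(real n)\<^sup>2 * 2 powr (- ((real s0 * real (Q * a) * real (Q * a - 1) / 2
        - 16 * real b * real Q * real n) / real (max b 1))) < 1"
begin

abbreviation "X \<equiv> rc_board s n"
abbreviation "wins \<equiv> maker_wins_from X (rc_winning_sets s n) b"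

text \<open>At most \<open>s * card W\<close> of at least \<open>\<eta> * s * n\<close> available
  edges lead into \<open>W\<close>; this is the inverse of that fraction.\<close>

definition trap_scale :: "nat set \<Rightarrow> real" where
  "trap_scale W = \<eta> * real n / real (card W)"

lemma n_pos: "0 < n"
proof (rule ccontr)
  assume "\<not> 0 < n"
  then have "16 * real Q * real a \<le> 0" using Qa by simp
  then show False using Q3 a1 by (simp add: mult_le_0_iff)
qed

lemma trap_scale_ge_1:
  assumes "(A, W) \<in> trap_family n Q a"
  shows "1 \<le> trap_scale W" "0 < card W"
proof -
  obtain k where k: "1 \<le> k" "k \<le> a" "card W = Q * k"
    using assms by (auto simp: trap_family_def)
  show W: "0 < card W" using k Q3 by simp
  have "real (card W) \<le> real Q * real a" using k by (simp add: mult_left_mono)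
  also have "\<dots> \<le> 16 * real Q * real a" by simp
  also have "\<dots> \<le> \<eta>\<^sup>2 * real n" by (rule Qa)
  also have "\<dots> \<le> \<eta> * real n" using \<eta> by (intro mult_right_mono) (auto simp: power2_eq_square mult_left_le)
  finally show "1 \<le> trap_scale W" using W by (simp add: trap_scale_def)
qed

text \<open>\<open>M0\<close> is Maker's graph at the start of the second stage; fixing it keeps the
  linker sets unchanged.\<close>

definition stage2 :: "(nat \<times> nat set) set \<Rightarrow> (nat \<times> nat set) set \<Rightarrow> (nat \<times> nat set) set \<Rightarrow> bool" where
  "stage2 M0 M B \<longleftrightarrow> M0 \<subseteq> M \<and> M \<subseteq> X \<and> B \<subseteq> X \<and>
     beck_potential (max b 1) {(x, y). x < n \<and> y < n \<and> x \<noteq> y} (\<lambda>(x, y). linkers s0 n M0 x y) M B < 1"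

text \<open>On a full board a linker set missed by Maker lies inside \<open>B\<close> and has weight
  1, but the potential stays below 1.\<close>

lemma maker_wins_stage2:
  assumes "stage2 M0 M B"
  shows "wins M B"
proof (rule maker_wins_from_strategy[where I = "stage2 M0"])
  fix M B assume I: "stage2 M0 M B"
  let ?P = "{(x, y). x < n \<and> y < n \<and> x \<noteq> y}" and ?E = "\<lambda>(x, y). linkers s0 n M0 x y"
  have finP: "finite ?P" by (rule finite_subset[of _ "{..<n} \<times> {..<n}"]) auto
  have E: "?E p \<subseteq> X" for p using linkers_subset_board[OF s0] by (auto split: prod.split)
  show "wins M B \<or> (\<exists>x \<in> X - (M \<union> B). \<forall>D. D \<subseteq> X - (M \<union> B) - {x} \<and> card D \<le> b \<longrightarrow>
      stage2 M0 (insert x M) (B \<union> D))"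
  proof (cases "X - (M \<union> B) = {}")
    case True
    have "rainbow_path M x y" if "x < n" "y < n" "x \<noteq> y" for x y
    proof -
      have "linkers s0 n M0 x y \<inter> M \<noteq> {}"
      proof
        assume dis: "linkers s0 n M0 x y \<inter> M = {}"
        then have "linkers s0 n M0 x y - B = {}" using True E[of "(x, y)"] by auto
        then have "beck_weight (max b 1) B (?E (x, y)) = 1" by (simp only: beck_weight_def prod.case) simp
        moreover have "beck_weight (max b 1) B (?E (x, y)) \<le> beck_potential (max b 1) ?P ?E M B"
          unfolding beck_potential_def using finP that dis
          by (intro member_le_sum[of "(x, y)" _ "\<lambda>p. beck_weight (max b 1) B (?E p)"]) (auto simp: beck_weight_def)
        ultimately show False using I by (simp add: stage2_def)
      qed
      then show ?thesis using rainbow_path_of_linker I by (auto simp: stage2_def)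
    qed
    then have "M \<in> rc_winning_sets s n"
      using I by (auto simp: rc_winning_sets_def rainbow_connected_def stage2_def)
    then show ?thesis using True maker_wins_from.finished by blast
  next
    case False
    show ?thesis
    proof (rule beck_step[where E = ?E and P = ?P and X = X and b = "max b 1" and M = M and B = B])
      fix x assume x: "x \<in> X - (M \<union> B)"
        "\<And>D. D \<subseteq> X - (M \<union> B) - {x} \<Longrightarrow> card D \<le> max b 1 \<Longrightarrow>
           beck_potential (max b 1) ?P ?E (insert x M) (B \<union> D) \<le> beck_potential (max b 1) ?P ?E M B"
      show ?thesis
      proof (rule disjI2, rule bexI[OF _ x(1)], intro allI impI)
        fix D assume D: "D \<subseteq> X - (M \<union> B) - {x} \<and> card D \<le> b"
        then have "card D \<le> max b 1" by (simp add: max.coboundedI1)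
        then have "beck_potential (max b 1) ?P ?E (insert x M) (B \<union> D) < 1"
          using x(2)[of D] I D by (auto simp: stage2_def)
        then show "stage2 M0 (insert x M) (B \<union> D)" using I D x(1) unfolding stage2_def by blast
      qed
    next
      fix p show "?E p \<subseteq> X" by (rule E)
    qed (use finP False in simp_all)
  qed
qed (use assms in auto)

text \<open>Even if all of Breaker's edges so far lay in one linker set, enough of that set would
  remain for the weights of at most \<open>n\<^sup>2\<close> pairs to sum to less than 1.\<close>

lemma stage2_start:
  assumes M: "M \<subseteq> X" and B: "B \<subseteq> X" "card B \<le> b * (16 * Q * n)"
    and out: "\<And>v. v < n \<Longrightarrow> card (out v) = 16 * Q" "\<And>v. v < n \<Longrightarrow> inj_on fst (out v)"
      "\<And>v c h. v < n \<Longrightarrow> (c, h) \<in> out v \<Longrightarrow> s0 \<le> c \<and> h < n \<and> (c, {v, h}) \<in> M"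
    and pot: "trap_potential (16 * Q) (8 * Q) trap_scale (trap_family n Q a) out < 1"
  shows "stage2 M M B"
proof -
  have Qan: "Q * a \<le> n"
  proof -
    have "real (Q * a) \<le> 16 * real Q * real a" by simp
    also have "\<dots> \<le> \<eta>\<^sup>2 * real n" by (rule Qa)
    also have "\<dots> \<le> 1 * real n" using \<eta> by (intro mult_right_mono) (auto simp: power_le_one)
    finally have "real (Q * a) \<le> real n" by simp
    then show ?thesis by (simp only: of_nat_le_iff)
  qed
  interpret expanding_out_sets n Q a s0 M out
  proof
    fix A W assume AW: "(A, W) \<in> trap_family n Q a"
    show "\<exists>v\<in>A. card {p \<in> out v. snd p \<in> W} < 8 * Q"
    proof (rule trap_potential_small[OF pot finite_trap_family _ AW])
      fix v assume "v \<in> A"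
      then show "card (out v) = 16 * Q" using AW out(1) by (auto simp: trap_family_def)
    qed (rule trap_scale_ge_1)
  qed (use out Q3 a1 Qan Qpow in auto)
  let ?P = "{(x, y). x < n \<and> y < n \<and> x \<noteq> y}" and ?E = "\<lambda>(x, y). linkers s0 n M x y"
  let ?r = "2 powr (- ((real s0 * real (Q * a) * real (Q * a - 1) / 2
        - 16 * real b * real Q * real n) / real (max b 1)))"
  have finP: "finite ?P" by (rule finite_subset[of _ "{..<n} \<times> {..<n}"]) auto
  have "card ?P \<le> card ({..<n} \<times> {..<n})" by (rule card_mono) auto
  then have cardP: "real (card ?P) \<le> (real n)\<^sup>2"
    by (simp add: card_cartesian_product power2_eq_square flip: of_nat_mult)
  have "beck_potential (max b 1) ?P ?E M B \<le> (\<Sum>p\<in>?P. beck_weight (max b 1) B (?E p))"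
    unfolding beck_potential_def using finP by (intro sum_mono2) (auto simp: beck_weight_def)
  also have "\<dots> \<le> (\<Sum>p\<in>?P. ?r)"
  proof (rule sum_mono, clarify)
    fix x y assume xy: "x < n" "y < n" "x \<noteq> y"
    let ?L = "linkers s0 n M x y"
    have "real (s0 * (Q * a * (Q * a - 1))) \<le> real (2 * card ?L)"
      using card_linkers_ge[OF xy(1,2)] by (simp only: of_nat_le_iff)
    then have 1: "real s0 * real (Q * a) * real (Q * a - 1) / 2 \<le> real (card ?L)"
      by (simp only: of_nat_mult)
    have "card ?L - card B \<le> card (?L - B)"
      by (intro diff_card_le_card_Diff finite_subset[OF B(1)] finite_rc_board)
    then have "real (card ?L) \<le> real (card (?L - B)) + real (card B)" by linarith
    moreover have "real (card B) \<le> 16 * real b * real Q * real n"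
    proof -
      have "real (card B) \<le> real (b * (16 * Q * n))" using B(2) by (simp only: of_nat_le_iff)
      then show ?thesis by (simp add: mult_ac)
    qed
    ultimately have "real s0 * real (Q * a) * real (Q * a - 1) / 2 - 16 * real b * real Q * real n
        \<le> real (card (?L - B))" using 1 by linarith
    then have "(real s0 * real (Q * a) * real (Q * a - 1) / 2 - 16 * real b * real Q * real n) / real (max b 1)
        \<le> real (card (?L - B)) / real (max b 1)" by (rule divide_right_mono) simp
    then show "beck_weight (max b 1) B ?L \<le> ?r" unfolding beck_weight_def by simp
  qed
  also have "\<dots> = real (card ?P) * ?r" by simp
  also have "\<dots> \<le> (real n)\<^sup>2 * ?r" using cardP by (intro mult_right_mono) auto
  also have "\<dots> < 1" by (rule beck)
  finally show ?thesis using M B(1) by (simp add: stage2_def)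
qed

text \<open>The reward of \<open>2 * real b\<close> per out-edge is the most that Breaker can add to
  all stars together in one round.\<close>

definition danger :: "(nat \<times> nat set) set \<Rightarrow> (nat \<Rightarrow> (nat \<times> nat) set) \<Rightarrow> nat \<Rightarrow> real" where
  "danger B out v = real (card (rc_star s n v \<inter> B)) - 2 * real b * real (card (out v))"

definition active :: "(nat \<Rightarrow> (nat \<times> nat) set) \<Rightarrow> nat set" where
  "active out = {v. v < n \<and> card (out v) < 16 * Q}"

text \<open>Each move of Maker adds one out-edge, so the sum of the \<open>card (out v)\<close>
  counts the rounds played.\<close>

definition stage1 :: "(nat \<times> nat set) set \<Rightarrow> (nat \<times> nat set) set \<Rightarrow> (nat \<Rightarrow> (nat \<times> nat) set) \<Rightarrow> bool" where
  "stage1 M B out \<longleftrightarrow> M \<subseteq> X \<and> B \<subseteq> X \<and> card M \<le> (\<Sum>v<n. card (out v)) \<and> card B \<le> b * (\<Sum>v<n. card (out v)) \<and>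
     (\<forall>v<n. finite (out v) \<and> card (out v) \<le> 16 * Q \<and> inj_on fst (out v) \<and>
        (\<forall>(c, h)\<in>out v. s0 \<le> c \<and> h < n \<and> (c, {v, h}) \<in> M)) \<and>
     avg_bounded n (2 * real b) (active out) (danger B out) \<and>
     trap_potential (16 * Q) (8 * Q) trap_scale (trap_family n Q a) out < 1"

definition available :: "(nat \<times> nat set) set \<Rightarrow> (nat \<times> nat set) set \<Rightarrow> (nat \<Rightarrow> (nat \<times> nat) set) \<Rightarrow> nat \<Rightarrow> (nat \<times> nat) set" where
  "available M B out v = {(c, h). s0 \<le> c \<and> c < s \<and> h < n \<and> h \<noteq> v \<and> c \<notin> fst ` out v \<and> (c, {v, h}) \<notin> M \<union> B}"

lemma sum_card_out_le:
  assumes "stage1 M B out"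
  shows "(\<Sum>v<n. card (out v)) \<le> 16 * Q * n"
proof -
  have "(\<Sum>v<n. card (out v)) \<le> (\<Sum>v<n. 16 * Q)"
    using assms by (intro sum_mono) (auto simp: stage1_def)
  then show ?thesis by (simp add: mult.commute)
qed

text \<open>The averaged bound is applied to the set \<open>{v}\<close>; undoing the reward for
  fewer than \<open>16 * Q\<close> out-edges gives the second term.\<close>

lemma danger_le:
  assumes "stage1 M B out" "v \<in> active out"
  shows "real (card (rc_star s n v \<inter> B)) \<le> 2 * real b * (harm n + 16 * real Q)"
proof -
  have "\<And>J. J \<subseteq> active out \<Longrightarrow> J \<noteq> {} \<Longrightarrow>
      sum (danger B out) J \<le> 2 * real b * real (card J) * (\<Sum>j=card J..n. 1 / real j)"
    using assms(1) unfolding stage1_def avg_bounded_def by blast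
  from this[of "{v}"] have "danger B out v \<le> 2 * real b * (\<Sum>j=1..n. 1 / real j)"
    using assms(2) by simp
  also have "(\<Sum>j=1..n. 1 / real j) = harm n" by (simp add: harm_def divide_inverse)
  finally have "real (card (rc_star s n v \<inter> B)) \<le> 2 * real b * harm n + 2 * real b * real (card (out v))"
    by (simp add: danger_def)
  moreover have "2 * real b * real (card (out v)) \<le> 2 * real b * (16 * real Q)"
    using assms(2) by (intro mult_left_mono) (auto simp: active_def)
  ultimately show ?thesis by (simp add: algebra_simps)
qed

text \<open>Of the \<open>(s - s0) * (n - 1)\<close> unreserved edges at \<open>v\<close>, Maker's
  edges and the edges of colours used in \<open>out v\<close> exclude at most
  \<open>16 * Q * n\<close> each; Breaker's edges in the star exclude the rest.\<close>

lemma card_available_ge: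
  assumes st: "stage1 M B out" and v: "v \<in> active out"
  shows "finite (available M B out v)" "\<eta> * real s * real n \<le> real (card (available M B out v))"
proof -
  let ?Av = "available M B out v" and ?g = "\<lambda>(c, h). (c, {v, h})"
  have vn: "v < n" using v by (simp add: active_def)
  show finAv: "finite ?Av"
    by (rule finite_subset[of _ "{..<s} \<times> {..<n}"]) (auto simp: available_def)
  have o: "finite (out v)" "card (out v) \<le> 16 * Q" using st vn by (auto simp: stage1_def)
  have finM: "finite M" "finite B" using st finite_rc_board by (auto simp: stage1_def intro: finite_subset)
  let ?R = "{s0..<s} \<times> ({..<n} - {v})"
  have injg: "inj_on ?g R" if "R \<subseteq> ?R" for R
    using that by (auto simp: inj_on_def doubleton_eq_iff)
  let ?RM = "{p \<in> ?R. ?g p \<in> M}" and ?RB = "{p \<in> ?R. ?g p \<in> B}"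
  have "card ?RM \<le> card M" by (rule card_inj_on_le[OF injg]) (use finM in auto)
  also have "\<dots> \<le> 16 * Q * n" using st sum_card_out_le[OF st] by (simp add: stage1_def)
  finally have RM: "card ?RM \<le> 16 * Q * n" .
  have RB: "card ?RB \<le> card (rc_star s n v \<inter> B)"
  proof (rule card_inj_on_le[OF injg])
    show "?g ` ?RB \<subseteq> rc_star s n v \<inter> B" using vn by (auto simp: rc_star_def)
  qed auto
  have "card (fst ` out v \<times> {..<n}) \<le> 16 * Q * n"
    using card_image_le[OF o(1), of fst] o(2) by (simp add: card_cartesian_product)
  moreover have "?R \<subseteq> ?Av \<union> (fst ` out v \<times> {..<n}) \<union> ?RM \<union> ?RB"
    by (auto simp: available_def)
  then have "card ?R \<le> card (?Av \<union> (fst ` out v \<times> {..<n}) \<union> ?RM \<union> ?RB)"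
    using finAv o(1) by (intro card_mono) auto
  moreover have "\<dots> \<le> card ?Av + card (fst ` out v \<times> {..<n}) + card ?RM + card ?RB"
    by (meson add_le_mono card_Un_le le_refl order_trans)
  ultimately have "card ?R \<le> card ?Av + 32 * Q * n + card (rc_star s n v \<inter> B)"
    using RM RB by linarith
  moreover have "card ?R = (s - s0) * (n - 1)" using vn by (simp add: card_cartesian_product)
  ultimately have "real ((s - s0) * (n - 1)) \<le> real (card ?Av + 32 * Q * n + card (rc_star s n v \<inter> B))"
    by (simp only: of_nat_le_iff)
  then have "real (s - s0) * real (n - 1) \<le> real (card ?Av) + 32 * real Q * real n + real (card (rc_star s n v \<inter> B))"
    by simp
  then show "\<eta> * real s * real n \<le> real (card ?Av)"
    using danger_le[OF st v] degree by linarith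
qed

text \<open>The danger decides the vertex and the trap potential the edge. The two choices do not
  interfere, because the danger sees only the size of the out-set.\<close>

lemma stage1_move:
  assumes st: "stage1 M B out" and s: "0 < s"
    and v: "v \<in> active out" "\<And>u. u \<in> active out \<Longrightarrow> danger B out u \<le> danger B out v"
  obtains c h where "(c, h) \<in> available M B out v"
    "\<And>D. D \<subseteq> X - (M \<union> B) - {(c, {v, h})} \<Longrightarrow> card D \<le> b \<Longrightarrow>
       stage1 (insert (c, {v, h}) M) (B \<union> D) (out(v := insert (c, h) (out v)))"
proof -
  let ?Av = "available M B out v"
  have vn: "v < n" "card (out v) < 16 * Q" using v by (auto simp: active_def)
  have o: "\<And>u. u < n \<Longrightarrow> finite (out u)" "\<And>u. u < n \<Longrightarrow> card (out u) \<le> 16 * Q"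
    "\<And>u. u < n \<Longrightarrow> inj_on fst (out u)"
    "\<And>u c h. u < n \<Longrightarrow> (c, h) \<in> out u \<Longrightarrow> s0 \<le> c \<and> h < n \<and> (c, {u, h}) \<in> M"
    using st by (auto simp: stage1_def)
  note Av = card_available_ge[OF st v(1)]
  have "0 < \<eta> * real s * real n" using \<eta> s n_pos by simp
  then have "0 < real (card ?Av)" using Av(2) by linarith
  then have Avne: "?Av \<noteq> {}" by auto
  have "\<exists>p\<in>?Av. trap_potential (16 * Q) (8 * Q) trap_scale (trap_family n Q a) (out(v := insert p (out v)))
      \<le> trap_potential (16 * Q) (8 * Q) trap_scale (trap_family n Q a) out"
  proof (rule trap_potential_step[OF finite_trap_family _ _ Av(1) Avne])
    fix A W assume AW: "(A, W) \<in> trap_family n Q a"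
    then have AW': "A \<subseteq> {..<n}" "W \<subseteq> {..<n}" by (auto simp: trap_family_def)
    then show "finite A" using finite_subset by blast
    show "0 < trap_scale W" using trap_scale_ge_1(1)[OF AW] by simp
    have "card {p \<in> ?Av. snd p \<in> W} \<le> card ({..<s} \<times> W)"
      using finite_subset[OF AW'(2)] by (intro card_mono) (auto simp: available_def)
    then have "real (card {p \<in> ?Av. snd p \<in> W}) \<le> real s * real (card W)"
      by (simp add: card_cartesian_product flip: of_nat_mult)
    then have "trap_scale W * real (card {p \<in> ?Av. snd p \<in> W}) \<le> trap_scale W * (real s * real (card W))"
      using trap_scale_ge_1(1)[OF AW] by (intro mult_left_mono) auto
    also have "\<dots> = \<eta> * real s * real n"
      using trap_scale_ge_1(2)[OF AW] by (simp add: trap_scale_def)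
    also note Av(2)
    finally show "trap_scale W * real (card {p \<in> ?Av. snd p \<in> W}) \<le> real (card ?Av)" .
  qed (use o vn in \<open>force simp: available_def\<close>)+
  then obtain c h where p: "(c, h) \<in> ?Av" and
    pot: "trap_potential (16 * Q) (8 * Q) trap_scale (trap_family n Q a) (out(v := insert (c, h) (out v)))
      \<le> trap_potential (16 * Q) (8 * Q) trap_scale (trap_family n Q a) out"
    by (metis surj_pair)
  let ?out = "out(v := insert (c, h) (out v))" and ?x = "(c, {v, h})"
  have pc: "s0 \<le> c" "c < s" "h < n" "h \<noteq> v" "c \<notin> fst ` out v" "?x \<notin> M \<union> B" "(c, h) \<notin> out v"
    using p by (force simp: available_def)+
  have card_out: "card (?out u) = card (out u) + (if u = v then 1 else 0)" if "u < n" for u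
    using o(1)[OF vn(1)] pc(7) by simp
  have sum_out: "(\<Sum>u<n. card (?out u)) = (\<Sum>u<n. card (out u)) + 1"
  proof -
    have "(\<Sum>u<n. card (?out u)) = (\<Sum>u<n. card (out u) + (if u = v then 1 else 0))"
      using card_out by (intro sum.cong) auto
    then show ?thesis using vn(1) by (simp add: sum.distrib)
  qed
  have act: "active ?out \<subseteq> active out"
    using card_out by (fastforce simp: active_def split: if_splits)
  show thesis
  proof (rule that[OF p])
    fix D assume D: "D \<subseteq> X - (M \<union> B) - {?x}" "card D \<le> b"
    have finM: "finite M" "finite B" "finite D"
      using st D finite_rc_board unfolding stage1_def by (meson Diff_subset finite_subset order_trans)+
    have "card (insert ?x M) \<le> (\<Sum>u<n. card (?out u))"
      unfolding sum_out using finM pc st by (simp add: stage1_def)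
    moreover have "card (B \<union> D) \<le> b * (\<Sum>u<n. card (?out u))"
      unfolding sum_out using card_Un_le[of B D] D(2) st by (simp add: stage1_def distrib_left)
    moreover have "finite (?out u) \<and> card (?out u) \<le> 16 * Q \<and> inj_on fst (?out u) \<and>
        (\<forall>(c', h')\<in>?out u. s0 \<le> c' \<and> h' < n \<and> (c', {u, h'}) \<in> insert ?x M)" if "u < n" for u
      using o[OF that] pc vn card_out[OF that] by (cases "u = v") auto
    moreover have "avg_bounded n (2 * real b) (active ?out) (danger (B \<union> D) ?out)"
    proof (rule avg_bounded_step[where v = v and P = "active out" and d = "danger B out"])
      show "finite (active out)" by (simp add: active_def)
      show "card (active out) \<le> n"
        using card_mono[of "{..<n}" "active out"] by (auto simp: active_def)
      show "avg_bounded n (2 * real b) (active out) (danger B out)" using st by (simp add: stage1_def)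
      fix J assume J: "J \<subseteq> active ?out"
      then have Jn: "J \<subseteq> {..<n}" by (auto simp: active_def)
      then have finJ: "finite J" using finite_subset by blast
      have "sum (danger (B \<union> D) ?out) J \<le> (\<Sum>u\<in>J. danger B out u + real (card (rc_star s n u \<inter> D)) - (if u = v then 2 * real b else 0))"
      proof (rule sum_mono)
        fix u assume u: "u \<in> J"
        have "card (rc_star s n u \<inter> (B \<union> D)) \<le> card (rc_star s n u \<inter> B) + card (rc_star s n u \<inter> D)"
          by (metis Int_Un_distrib card_Un_le)
        moreover have "card (?out u) = card (out u) + (if u = v then 1 else 0)" using card_out Jn u by blast
        ultimately show "danger (B \<union> D) ?out u \<le> danger B out u + real (card (rc_star s n u \<inter> D)) - (if u = v then 2 * real b else 0)"
          unfolding danger_def by (simp add: algebra_simps split: if_splits)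
      qed
      also have "\<dots> = sum (danger B out) J + real (\<Sum>u\<in>J. card (rc_star s n u \<inter> D)) - (if v \<in> J then 2 * real b else 0)"
        using finJ by (simp add: sum.distrib sum_subtractf)
      also have "(\<Sum>u\<in>J. card (rc_star s n u \<inter> D)) \<le> 2 * b"
        using sum_card_rc_star_le[OF finJ, of D s n] D by (meson Diff_subset le_trans mult_le_mono2 subset_trans)
      finally show "sum (danger (B \<union> D) ?out) J \<le> sum (danger B out) J + 2 * real b - (if v \<in> J then 2 * real b else 0)"
        by simp
    qed (use v act in auto)
    moreover have "insert ?x M \<subseteq> X" "B \<union> D \<subseteq> X" using st D pc vn by (auto simp: stage1_def)
    ultimately show "stage1 (insert ?x M) (B \<union> D) ?out"
      using pot st unfolding stage1_def by auto
  qed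
qed

lemma maker_wins_stage1:
  assumes st: "stage1 M B out" and s: "0 < s"
  shows "wins M B"
proof (rule maker_wins_from_strategy[where I = "\<lambda>M B. \<exists>out. stage1 M B out"])
  fix M B assume "\<exists>out. stage1 M B out"
  then obtain out where st: "stage1 M B out" by blast
  show "wins M B \<or> (\<exists>x \<in> X - (M \<union> B). \<forall>D. D \<subseteq> X - (M \<union> B) - {x} \<and> card D \<le> b \<longrightarrow>
      (\<exists>out. stage1 (insert x M) (B \<union> D) out))"
  proof (cases "active out = {}")
    case True
    have "stage2 M M B"
    proof (rule stage2_start)
      show "card B \<le> b * (16 * Q * n)"
        using st sum_card_out_le[OF st] unfolding stage1_def by (meson le_trans mult_le_mono2)
      fix v assume "v < n"
      then show "card (out v) = 16 * Q" using True st by (force simp: active_def stage1_def)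
    qed (use st in \<open>auto simp: stage1_def\<close>)
    then show ?thesis using maker_wins_stage2 by blast
  next
    case False
    have "finite (active out)" by (simp add: active_def)
    then have "Max (danger B out ` active out) \<in> danger B out ` active out" using False by (intro Max_in) auto
    then obtain v where v: "Max (danger B out ` active out) = danger B out v" "v \<in> active out" by (rule imageE)
    have "danger B out u \<le> danger B out v" if "u \<in> active out" for u
      using Max_ge[of "danger B out ` active out" "danger B out u"] \<open>finite (active out)\<close> that v(1) by auto
    then obtain c h where ch: "(c, h) \<in> available M B out v"
      "\<And>D. D \<subseteq> X - (M \<union> B) - {(c, {v, h})} \<Longrightarrow> card D \<le> b \<Longrightarrow>
         stage1 (insert (c, {v, h}) M) (B \<union> D) (out(v := insert (c, h) (out v)))"
      using stage1_move[OF st s v(2)] by metis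
    have "(c, {v, h}) \<in> X - (M \<union> B)" using ch(1) v(2) by (auto simp: available_def active_def)
    then show ?thesis using ch(2) by blast
  qed
qed (use st in auto)

lemma maker_wins_rc:
  assumes "0 < s"
  shows "maker_wins X (rc_winning_sets s n) b"
  unfolding maker_wins_def
proof (rule maker_wins_stage1[OF _ assms])
  have "trap_potential (16 * Q) (8 * Q) trap_scale (trap_family n Q a) (\<lambda>_. {}) < 1"
    using trap_potential_initial[OF Q3 \<eta> Qa] unfolding trap_scale_def .
  moreover have "avg_bounded n (2 * real b) (active (\<lambda>_. {})) (danger {} (\<lambda>_. {}))"
    by (auto simp: avg_bounded_def danger_def sum_nonneg)
  ultimately show "stage1 {} {} (\<lambda>_. {})" by (simp add: stage1_def)
qed

end

section \<open>The upper bound\<close>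

text \<open>Each of the \<open>k\<close> roundings loses at most 1.\<close>

lemma sum_div_ge: "real b * harm k - real k \<le> real (\<Sum>j=1..k. b div j)"
proof -
  have "real b * harm k - real k = (\<Sum>j=1..k. real b / real j - 1)"
    by (simp add: harm_def sum_subtractf sum_distrib_left divide_inverse)
  also have "\<dots> \<le> (\<Sum>j=1..k. real (b div j))"
  proof (rule sum_mono)
    fix j assume "j \<in> {1..k}"
    show "real b / real j - 1 \<le> real (b div j)"
      using floor_divide_of_nat_eq[of b j, where 'a = real] by linarith
  qed
  finally show ?thesis by simp
qed

lemma eventually_ln_le:
  assumes range: "\<And>n. n \<ge> 1 \<Longrightarrow> 1 \<le> s n \<and> s n \<le> n"
    and growth: "(\<lambda>n. ln (real n) / real (s n)) \<longlonglongrightarrow> 0" and "0 < C"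
  shows "eventually (\<lambda>n. C * ln (real n) \<le> real (s n)) sequentially"
proof -
  have "eventually (\<lambda>n. ln (real n) / real (s n) < 1 / C) sequentially"
    using growth assms(3) by (intro order_tendstoD(2)) auto
  then show ?thesis using eventually_ge_at_top[of 1]
  proof eventually_elim
    case (elim n)
    then have "0 < real (s n)" using range[of n] by simp
    then show ?case using elim(1) assms(3) by (simp add: field_simps)
  qed
qed

text \<open>A clique of about \<open>n / (4 * l)\<close> vertices is small enough that adding two
  per round costs at most \<open>b\<close>, yet \<open>ln m\<close> is close enough to
  \<open>l\<close> for the harmonic sum times \<open>b\<close> to exceed
  \<open>s * n\<close>.\<close>

lemma breaker_wins_rc:
  fixes n s :: nat and e :: real
  defines "l \<equiv> ln (real n)"
  assumes "0 < e" "1 \<le> s" "1 \<le> l" "16 * l \<le> n" "20 \<le> n"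
    and "(1 + e / 2) * l \<le> (1 + e) * ln (real n / (8 * l))" "4 \<le> e * real s"
  shows "\<not> maker_wins (rc_board s n) (rc_winning_sets s n) (nat \<lfloor>(1 + e) * real s * real n / l\<rfloor>)"
proof -
  define m where "m = nat \<lfloor>real n / (4 * l)\<rfloor>"
  define b where "b = nat \<lfloor>(1 + e) * real s * real n / l\<rfloor>"
  have nl: "4 \<le> real n / (4 * l)" using assms by (simp add: field_simps)
  have m_le: "real m \<le> real n / (4 * l)" and m_ge: "real n / (4 * l) - 1 \<le> real m"
    using nl unfolding m_def by linarith+
  have b_le: "real b \<le> (1 + e) * real s * real n / l" and b_ge: "(1 + e) * real s * real n / l - 1 \<le> real b"
  proof -
    have "0 \<le> (1 + e) * real s * real n / l" using assms by simp
    then show "real b \<le> (1 + e) * real s * real n / l" "(1 + e) * real s * real n / l - 1 \<le> real b"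
      unfolding b_def by linarith+
  qed
  have nl4: "real n / (4 * l) \<le> real n / 4" using assms(4) by (intro divide_left_mono) auto
  have m3: "3 \<le> m" using nl m_ge by linarith
  have "\<not> maker_wins (rc_board s n) (rc_winning_sets s n) b"
  proof (rule breaker_wins_clique_box[of m])
    show "1 \<le> m" using m3 by simp
    show "3 * m + 5 \<le> n" using m_le nl4 assms(6) by linarith
    show "2 * s * m \<le> b"
    proof -
      have "real (2 * s * m) = 2 * real s * real m" by simp
      also have "\<dots> \<le> 2 * real s * (real n / (4 * l))" using m_le by (intro mult_left_mono) auto
      also have "\<dots> \<le> (1 + e) * real s * real n / l"
        using assms by (simp add: field_simps mult_right_mono)
      finally show ?thesis unfolding b_def by linarith
    qed
    have "real (s * n) \<le> real b * harm (m - 1) - real (m - 1)"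
    proof -
      have "real n / (8 * l) \<le> real m" using m_ge nl by (simp add: field_simps)
      moreover have "0 < real n / (8 * l)" using assms by simp
      ultimately have "ln (real n / (8 * l)) \<le> ln (real m)" by simp
      then have 1: "(1 + e / 2) * l \<le> (1 + e) * ln (real m)"
        using assms(2,7) by (smt (verit) mult_left_mono)
      have lnm: "0 \<le> ln (real m)" "ln (real m) \<le> real m" using m3 ln_le_minus_one[of "real m"] by auto
      have harm: "ln (real m) \<le> harm (m - 1)" using ln_le_harm[of "m - 1"] m3 by (simp add: of_nat_diff)
      \<comment> \<open>The slack \<open>2 * real n\<close> pays for the rounding of
        \<open>b\<close>, which costs \<open>ln m\<close>, and that of the quotients
        \<open>b div j\<close>, which costs less than \<open>m\<close>.\<close>
      have "2 * real n \<le> e * real s * real n / 2" using mult_right_mono[OF assms(8), of "real n"] by simp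
      then have "real s * real n + 2 * real n \<le> real s * real n / l * ((1 + e / 2) * l)"
        using assms(4) by (simp add: field_simps)
      also have "\<dots> \<le> real s * real n / l * ((1 + e) * ln (real m))"
        using 1 assms(4) by (intro mult_left_mono) auto
      also have "\<dots> = ((1 + e) * real s * real n / l - 1) * ln (real m) + ln (real m)"
        by (simp add: field_simps)
      also have "\<dots> \<le> real b * ln (real m) + real m"
        using b_ge lnm by (intro add_mono mult_right_mono) auto
      also have "\<dots> \<le> real b * harm (m - 1) + real m"
        using harm by (intro add_mono mult_left_mono) auto
      finally have "real s * real n + 2 * real n \<le> real b * harm (m - 1) + real m" .
      moreover have "real m \<le> real n" using m_le nl4 by linarith
      ultimately show ?thesis by simp
    qed
    also have "\<dots> \<le> real (\<Sum>j=1..m-1. b div j)" by (rule sum_div_ge)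
    finally show "s * n \<le> (\<Sum>j=1..m-1. b div j)" by (simp only: of_nat_le_iff)
  qed
  then show ?thesis by (simp add: b_def)
qed

lemma eventually_breaker_wins_rc:
  fixes s :: "nat \<Rightarrow> nat"
  assumes range: "\<And>n. n \<ge> 1 \<Longrightarrow> 1 \<le> s n \<and> s n \<le> n"
    and growth: "(\<lambda>n. ln (real n) / real (s n)) \<longlonglongrightarrow> 0" and "0 < e"
  shows "eventually (\<lambda>n. \<not> maker_wins (rc_board (s n) n) (rc_winning_sets (s n) n)
     (nat \<lfloor>(1 + e) * real (s n) * real n / ln (real n)\<rfloor>)) sequentially"
proof -
  have "((\<lambda>n::nat. ln (real n / (8 * ln (real n))) / ln (real n)) \<longlongrightarrow> 1) sequentially" by real_asymp
  moreover have "(1 + e / 2) / (1 + e) < 1" using assms(3) by (simp add: field_simps)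
  ultimately have "eventually (\<lambda>n::nat. (1 + e / 2) / (1 + e) < ln (real n / (8 * ln (real n))) / ln (real n)) sequentially"
    by (rule order_tendstoD)
  moreover have "eventually (\<lambda>n::nat. 1 \<le> ln (real n)) sequentially" by real_asymp
  moreover have "eventually (\<lambda>n::nat. 16 * ln (real n) \<le> real n) sequentially" by real_asymp
  moreover have "eventually (\<lambda>n. 4 / e * ln (real n) \<le> real (s n)) sequentially"
    using assms by (intro eventually_ln_le) auto
  ultimately show ?thesis using eventually_ge_at_top[of 20]
  proof eventually_elim
    case (elim n)
    have "4 / e * 1 \<le> 4 / e * ln (real n)" using elim(2) assms(3) by (intro mult_left_mono) auto
    then have "4 / e \<le> real (s n)" using elim(4) by linarith
    then have "4 \<le> e * real (s n)" using assms(3) by (simp add: field_simps)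
    moreover have "(1 + e / 2) * ln (real n) \<le> (1 + e) * ln (real n / (8 * ln (real n)))"
      using elim(1,2) assms(3) by (simp add: field_simps)
    ultimately show ?case using elim range[of n] assms(3) by (intro breaker_wins_rc) auto
  qed
qed

section \<open>The lower bound\<close>

lemma harm_le_ln:
  assumes "1 \<le> n"
  shows "harm n \<le> ln (real n) + 1"
  using euler_mascheroni_sequence_decreasing[of 1 n] assms by (simp add: harm_def)

text \<open>\<open>g\<close> is \<open>\<eta>\<^sup>2 / 16\<close> for
  \<open>\<eta> = e / 2\<close>, the largest ratio of \<open>Q * a\<close> to \<open>n\<close>
  allowed. \<open>c\<close> bounds the ratio of \<open>Q\<close> to \<open>l\<close>:
  \<open>e / 64\<close> keeps the degree losses small, and the other term keeps Breaker's
  first-stage edges within half of the linker bound. About \<open>e / 4\<close> of the colours are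
  reserved.\<close>

lemma maker_wins_rc_of_bounds:
  fixes n s b :: nat and e :: real
  defines "l \<equiv> ln (real n)" and "g \<equiv> e\<^sup>2 / 64"
  defines "c \<equiv> min (e / 64) (e * g\<^sup>2 / 2048)"
  assumes e: "0 < e" "e < 1/2" and s: "1 \<le> s"
    and b: "real b \<le> (1/2 - e) * real s * real n / l"
    and cl: "6 \<le> c * l" "2 * exp (2 / (3 * c)) \<le> c * l"
    and en: "4 / e \<le> l" "4 / e \<le> real n" and ls: "2 * l \<le> real s" "8 \<le> e * real s"
    and gn: "2 * (c * l) \<le> g * real n" "4 \<le> g * real n" "256 < ln 2 * e * g\<^sup>2 * real n"
    and ln: "2 * l \<le> real n"
  shows "maker_wins (rc_board s n) (rc_winning_sets s n) b"
proof -
  have "e\<^sup>2 \<le> 1" using e by (simp add: power_le_one)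
  then have g: "0 < g" "g \<le> 1" using e by (simp_all add: g_def)
  have c: "0 < c" "c \<le> e / 64" "c \<le> e * g\<^sup>2 / 2048" using e g by (simp_all add: c_def)
  define s0 where "s0 = nat \<lfloor>e / 4 * real s\<rfloor>"
  define Q where "Q = nat \<lfloor>c * l\<rfloor>"
  define a where "a = nat \<lfloor>g * real n / real Q\<rfloor>"
  define N where "N = real s * real n"
  have l: "0 < l" using cl(1) c(1) by (metis less_le_trans zero_less_mult_pos zero_less_numeral)
  have l8: "8 < l"
  proof -
    have "8 < 4 / e" using e by (simp add: field_simps)
    then show ?thesis using en(1) by linarith
  qed
  have n: "1 \<le> n" using ln l by (cases n) auto
  have N: "0 < N" using n s by (simp add: N_def)
  have s0: "real s0 \<le> e / 4 * real s" "e / 8 * real s \<le> real s0"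
  proof -
    have "0 \<le> e / 4 * real s" using e by simp
    then have "real s0 \<le> e / 4 * real s" "e / 4 * real s - 1 \<le> real s0" unfolding s0_def by linarith+
    moreover have "e / 4 * real s - 1 \<ge> e / 8 * real s" using ls(2) by simp
    ultimately show "real s0 \<le> e / 4 * real s" "e / 8 * real s \<le> real s0" by linarith+
  qed
  have Q: "real Q \<le> c * l" "c * l / 2 \<le> real Q" "3 \<le> Q" using cl(1) unfolding Q_def by linarith+
  have Qa_le: "real Q * real a \<le> g * real n" and Qa_ge: "g * real n / 2 \<le> real Q * real a"
  proof -
    have "0 \<le> g * real n / real Q" using g by simp
    then have a: "real a \<le> g * real n / real Q" "g * real n / real Q - 1 \<le> real a"
      unfolding a_def by linarith+
    show "real Q * real a \<le> g * real n" using a(1) Q(3) by (simp add: field_simps)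
    have "g * real n - real Q \<le> real Q * real a" using a(2) Q(3) by (simp add: field_simps)
    moreover have "real Q \<le> g * real n / 2" using Q(1) gn(1) by linarith
    ultimately show "g * real n / 2 \<le> real Q * real a" by linarith
  qed
  have a1: "1 \<le> a"
  proof (rule ccontr)
    assume "\<not> 1 \<le> a"
    then have "a = 0" by simp
    then show False using Qa_ge gn(2) by simp
  qed
  have b_half: "real b \<le> N / (2 * l)"
  proof -
    have "(1/2 - e) * real s * real n / l \<le> 1/2 * real s * real n / l"
      using e l by (intro divide_right_mono mult_right_mono) auto
    then show ?thesis using b by (simp add: N_def)
  qed
  have max_b: "real (max b 1) \<le> N / (2 * l)"
  proof -
    have "2 * l \<le> real s * real n" using ln mult_right_mono[of 1 "real s" "real n"] s by simp
    then have "1 \<le> N / (2 * l)" using l by (simp add: N_def field_simps)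
    then show ?thesis using b_half by (simp add: max_def)
  qed
  interpret maker_parameters n s s0 Q a b "e / 2"
  proof
    have "e / 4 * real s \<le> 1 * real s" using e by (intro mult_right_mono) auto
    then show s0s: "s0 \<le> s" using s0(1) by simp
    show "3 \<le> Q" by (rule Q(3))
    show "1 \<le> a" by (rule a1)
    show "0 < e / 2" "e / 2 \<le> 1" using e by auto
    show "16 * real Q * real a \<le> (e / 2)\<^sup>2 * real n"
      using Qa_le by (simp add: g_def power_divide)
    show "a \<le> Q ^ (3 * Q)"
    proof -
      have "1 * real a \<le> real Q * real a" using Q(3) by (intro mult_right_mono) auto
      moreover have "g * real n \<le> 1 * real n" using g by (intro mult_right_mono) auto
      ultimately have "real a \<le> real n" using Qa_le by linarith
      also have "\<dots> = exp l" using n by (simp add: l_def)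
      \<comment> \<open>By \<open>cl(2)\<close>, \<open>ln Q\<close> is at least
        \<open>2 / (3 * c)\<close>, and \<open>3 * Q\<close> is at least
        \<open>3 * c * l / 2\<close>; the product of these bounds is \<open>l\<close>.\<close>
      also have "l \<le> real (3 * Q) * ln (real Q)"
      proof -
        have "exp (2 / (3 * c)) \<le> real Q" using cl(2) Q(2) by linarith
        then have "2 / (3 * c) \<le> ln (real Q)" using Q(3) by (simp add: ln_ge_iff)
        then have "(3 * (c * l / 2)) * (2 / (3 * c)) \<le> real (3 * Q) * ln (real Q)"
          using Q(2,3) c(1) by (intro mult_mono) auto
        then show ?thesis using c(1) by (simp add: field_simps)
      qed
      also have "exp (real (3 * Q) * ln (real Q)) = real Q ^ (3 * Q)"
        using Q(3) by (simp only: exp_of_nat_mult) simp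
      finally have "real a \<le> real (Q ^ (3 * Q))" by simp
      then show ?thesis by (simp only: of_nat_le_iff)
    qed
    show "e / 2 * real s * real n \<le> real (s - s0) * real (n - 1)
        - 2 * real b * (harm n + 16 * real Q) - 32 * real Q * real n"
    proof -
      have 1: "N - e / 4 * N - e / 4 * N \<le> real (s - s0) * real (n - 1)"
      proof -
        have "N - e / 4 * N - real s \<le> (real s - e / 4 * real s) * (real n - 1)"
          using e by (simp add: N_def algebra_simps)
        also have "\<dots> \<le> real (s - s0) * real (n - 1)"
          using s0 s0s n e by (intro mult_mono) (auto simp: of_nat_diff)
        finally have "N - e / 4 * N - real s \<le> real (s - s0) * real (n - 1)" .
        moreover have "real s \<le> e / 4 * N"
        proof -
          have "1 \<le> e / 4 * real n" using en(2) e by (simp add: field_simps)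
          then have "real s * 1 \<le> real s * (e / 4 * real n)" by (intro mult_left_mono) auto
          then show ?thesis by (simp add: N_def mult_ac)
        qed
        ultimately show ?thesis by linarith
      qed
      \<comment> \<open>The factor 2 of the danger bound meets \<open>1/2 - e\<close> here, which
        leaves \<open>2 * e * N\<close> for all errors.\<close>
      have 2: "2 * real b * harm n \<le> (1 - 2 * e) * N + e / 4 * N"
      proof -
        have "2 * real b * harm n \<le> 2 * ((1/2 - e) * real s * real n / l) * (l + 1)"
          using b harm_le_ln[OF n] e l by (intro mult_mono) (auto simp: l_def harm_nonneg)
        also have "\<dots> = (1 - 2 * e) * N + (1 - 2 * e) * N / l"
          using l by (simp add: N_def field_simps)
        also have "(1 - 2 * e) * N / l \<le> e / 4 * N"
        proof -
          have "(1 - 2 * e) * N / l \<le> 1 * N / l"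
            using e l N by (intro divide_right_mono mult_right_mono) auto
          also have "\<dots> \<le> e / 4 * N"
          proof -
            have "1 / l \<le> e / 4" using en(1) e l by (simp add: field_simps)
            then have "1 / l * N \<le> e / 4 * N" using N by (intro mult_right_mono) auto
            then show ?thesis by simp
          qed
          finally show ?thesis .
        qed
        finally show ?thesis by simp
      qed
      have 3: "2 * real b * (16 * real Q) \<le> e / 4 * N"
      proof -
        have "2 * real b * (16 * real Q) \<le> 2 * (N / (2 * l)) * (16 * (c * l))"
          using b_half Q(1) N l c(1) by (intro mult_mono) auto
        also have "\<dots> = 16 * c * N" using l by (simp add: field_simps)
        also have "\<dots> \<le> e / 4 * N" using c(2) N by (intro mult_right_mono) auto
        finally show ?thesis .
      qed
      have 4: "32 * real Q * real n \<le> e / 4 * N"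
      proof -
        have "32 * real Q * real n \<le> 32 * (c * l) * real n" using Q(1) by (intro mult_right_mono) auto
        also have "\<dots> \<le> 32 * (e / 64 * l) * real n" using c(2) l by (intro mult_right_mono mult_left_mono) auto
        also have "\<dots> = e / 4 * (2 * l) * real n" by simp
        also have "\<dots> \<le> e / 4 * real s * real n" using ls(1) e by (intro mult_right_mono mult_left_mono) auto
        finally show ?thesis by (simp add: N_def mult.assoc)
      qed
      \<comment> \<open>Five errors of \<open>e / 4 * N\<close> against the gain
        \<open>2 * e * N\<close> leave \<open>3 * e / 4 * N\<close>, more than
        \<open>e / 2 * N\<close>.\<close>
      have "0 < e * N" using e N by simp
      then show ?thesis using 1 2 3 4 by (simp add: N_def algebra_simps)
    qed
    show "(real n)\<^sup>2 * 2 powr (- ((real s0 * real (Q * a) * real (Q * a - 1) / 2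
        - 16 * real b * real Q * real n) / real (max b 1))) < 1" (is "_ * 2 powr (- ?x) < 1")
    proof -
      \<comment> \<open>Each linker set has at least \<open>2 * ?k\<close> elements, and Breaker has
        taken at most \<open>?k\<close>.\<close>
      let ?k = "e * g\<^sup>2 * N * real n / 256"
      have "?k * 2 \<le> real s0 * real (Q * a) * real (Q * a - 1) / 2"
      proof -
        have "1 \<le> Q * a" using Q(3) a1 by simp
        then have m: "real (Q * a - 1) = real Q * real a - 1" by (simp add: of_nat_diff)
        have "g * real n / 4 \<le> g * real n / 2 - 1" using gn(2) by simp
        also have "\<dots> \<le> real (Q * a - 1)" unfolding m using Qa_ge by simp
        finally have "g * real n / 4 \<le> real (Q * a - 1)" .
        then have "(e / 8 * real s) * (g * real n / 2) * (g * real n / 4) \<le> real s0 * real (Q * a) * real (Q * a - 1)"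
          using s0(2) Qa_ge e g by (intro mult_mono) auto
        then show ?thesis by (simp add: N_def power2_eq_square algebra_simps)
      qed
      moreover have "16 * real b * real Q * real n \<le> ?k"
      proof -
        have "16 * real b * real Q * real n \<le> 16 * (N / (2 * l)) * (c * l) * real n"
          using b_half Q(1) N l c(1) by (intro mult_mono) auto
        also have "\<dots> = 8 * c * (N * real n)" using l by (simp add: field_simps)
        also have "\<dots> \<le> 8 * (e * g\<^sup>2 / 2048) * (N * real n)" using c(3) N by (intro mult_right_mono) auto
        finally show ?thesis by simp
      qed
      ultimately have k: "?k \<le> real s0 * real (Q * a) * real (Q * a - 1) / 2 - 16 * real b * real Q * real n" by linarith
      have k0: "0 \<le> ?k" using e N by simp
      have x: "e * g\<^sup>2 * real n * l / 128 \<le> ?x"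
      proof -
        have "e * g\<^sup>2 * real n * l / 128 = ?k / (N / (2 * l))" using N by (simp add: field_simps)
        also have "\<dots> \<le> ?x" by (rule frac_le[OF order_trans[OF k0 k] k _ max_b]) simp
        finally show ?thesis .
      qed
      \<comment> \<open>The factor \<open>n\<^sup>2\<close> equals \<open>exp (2 * l)\<close>, so
        the exponent has to beat \<open>2 * l\<close>.\<close>
      have "2 * l * 128 < ln 2 * e * g\<^sup>2 * real n * l" using mult_strict_right_mono[OF gn(3) l] by simp
      then have "2 * l < ln 2 * (e * g\<^sup>2 * real n * l / 128)" by simp
      also have "\<dots> \<le> ln 2 * ?x" using x by (intro mult_left_mono) auto
      finally have "exp (2 * l - ln 2 * ?x) < 1" by simp
      moreover have "exp (2 * l) = (real n)\<^sup>2" using n exp_of_nat_mult[of 2 l] by (simp add: l_def)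
      moreover have "2 powr (- ?x) = exp (- (ln 2 * ?x))" by (simp add: powr_def mult.commute)
      ultimately show ?thesis by (simp only: diff_conv_add_uminus exp_add)
    qed
  qed
  show ?thesis using maker_wins_rc s by simp
qed

lemma eventually_maker_wins_rc:
  fixes s :: "nat \<Rightarrow> nat"
  assumes range: "\<And>n. n \<ge> 1 \<Longrightarrow> 1 \<le> s n \<and> s n \<le> n"
    and growth: "(\<lambda>n. ln (real n) / real (s n)) \<longlonglongrightarrow> 0" and e: "0 < e" "e < 1/2"
  shows "eventually (\<lambda>n. \<forall>b. real b \<le> (1/2 - e) * real (s n) * real n / ln (real n) \<longrightarrow>
     maker_wins (rc_board (s n) n) (rc_winning_sets (s n) n) b) sequentially"
proof -
  define g where "g = e\<^sup>2 / 64"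
  define c where "c = min (e / 64) (e * g\<^sup>2 / 2048)"
  have g: "0 < g" using e by (simp add: g_def)
  then have c: "0 < c" using e by (simp add: c_def)
  define d where "d = ln 2 * e * g\<^sup>2"
  have d: "0 < d" using e g by (simp add: d_def)
  have lin: "filterlim (\<lambda>n::nat. ln (real n)) at_top sequentially" by real_asymp
  then have ln_ge: "eventually (\<lambda>n::nat. C \<le> ln (real n)) sequentially" for C
    unfolding filterlim_at_top by blast
  have n_ge: "eventually (\<lambda>n::nat. C \<le> real n) sequentially" for C
    using filterlim_real_sequentially unfolding filterlim_at_top by blast
  have "eventually (\<lambda>n::nat. ln (real n) < C * real n) sequentially" if "0 < C" for C :: real
  proof -
    have "((\<lambda>n::nat. ln (real n) / real n) \<longlongrightarrow> 0) sequentially" by real_asymp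
    from order_tendstoD(2)[OF this that] show ?thesis using eventually_gt_at_top[of 0]
      by eventually_elim (simp add: field_simps)
  qed
  note ln_less = this
  have "eventually (\<lambda>n. ln (real n) < (g / (2 * c)) * real n) sequentially"
    "eventually (\<lambda>n. ln (real n) < 1 / 2 * real n) sequentially"
    using g c by (intro ln_less; simp)+
  moreover have "eventually (\<lambda>n. max (6 / c) (max (2 * exp (2 / (3 * c)) / c) (max (4 / e) 1)) \<le> ln (real n)) sequentially"
    by (rule ln_ge)
  moreover have "eventually (\<lambda>n. max (4 / e) (max (4 / g) (257 / d)) \<le> real n) sequentially" by (rule n_ge)
  moreover have "eventually (\<lambda>n. (2 + 8 / e) * ln (real n) \<le> real (s n)) sequentially"
    using e by (intro eventually_ln_le[OF range growth]) (auto intro: add_pos_pos)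
  ultimately show ?thesis using eventually_ge_at_top[of 1]
  proof eventually_elim
    case (elim n)
    show ?case
    proof (intro allI impI, rule maker_wins_rc_of_bounds[OF e])
      show "1 \<le> s n" using range elim by blast
      show "6 \<le> min (e / 64) (e * (e\<^sup>2 / 64)\<^sup>2 / 2048) * ln (real n)"
        using elim(3) c unfolding g_def[symmetric] c_def[symmetric] by (simp add: field_simps)
      show "2 * exp (2 / (3 * min (e / 64) (e * (e\<^sup>2 / 64)\<^sup>2 / 2048))) \<le> min (e / 64) (e * (e\<^sup>2 / 64)\<^sup>2 / 2048) * ln (real n)"
        using elim(3) c unfolding g_def[symmetric] c_def[symmetric] by (simp add: field_simps)
      show "4 / e \<le> ln (real n)" "4 / e \<le> real n" using elim(3,4) by auto
      have l1: "1 \<le> ln (real n)" using elim(3) by simp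
      have "0 \<le> 8 / e * ln (real n)" using e l1 by simp
      then show "2 * ln (real n) \<le> real (s n)" using elim(5) by (simp add: distrib_right)
      have "8 / e * 1 \<le> 8 / e * ln (real n)" using e l1 by (intro mult_left_mono) auto
      then have "8 / e \<le> real (s n)" using elim(5) l1 by (simp add: distrib_right)
      then show "8 \<le> e * real (s n)" using e by (simp add: field_simps)
      show "2 * (min (e / 64) (e * (e\<^sup>2 / 64)\<^sup>2 / 2048) * ln (real n)) \<le> e\<^sup>2 / 64 * real n"
        using elim(1) c unfolding g_def[symmetric] c_def[symmetric] by (simp add: field_simps)
      show "4 \<le> e\<^sup>2 / 64 * real n"
        using elim(4) g unfolding g_def[symmetric] by (simp add: field_simps)
      have "257 \<le> d * real n" using elim(4) d by (simp add: field_simps)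
      then show "256 < ln 2 * e * (e\<^sup>2 / 64)\<^sup>2 * real n" unfolding g_def[symmetric] d_def[symmetric] by simp
      show "2 * ln (real n) \<le> real n" using elim(2) by simp
    qed
  qed
qed

theorem theorem1p5:
  fixes s :: "nat \<Rightarrow> nat"
  assumes range: "\<And>n. n \<ge> 1 \<Longrightarrow> 1 \<le> s n \<and> s n \<le> n"
    and growth: "(\<lambda>n. ln (real n) / real (s n)) \<longlonglongrightarrow> 0"
  shows "\<forall>\<epsilon>>0. eventually (\<lambda>n.
      (1/2 - \<epsilon>) * real (s n) * real n / ln (real n) \<le> real (rc_threshold (s n) n) \<and>
      real (rc_threshold (s n) n) \<le> (1 + \<epsilon>) * real (s n) * real n / ln (real n)) sequentially"
proof (intro allI impI)
  fix \<epsilon> :: real assume \<epsilon>: "\<epsilon> > 0"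
  \<comment> \<open>The lower bound is available for \<open>e < 1/2\<close>, and a smaller
    \<open>e\<close> makes it stronger.\<close>
  define e where "e = min \<epsilon> (1/4)"
  have e: "0 < e" "e < 1/2" "e \<le> \<epsilon>" using \<epsilon> by (auto simp: e_def)
  have "eventually (\<lambda>n. \<forall>b. real b \<le> (1/2 - e) * real (s n) * real n / ln (real n) \<longrightarrow>
     maker_wins (rc_board (s n) n) (rc_winning_sets (s n) n) b) sequentially"
    using range growth e(1,2) by (rule eventually_maker_wins_rc)
  moreover have "eventually (\<lambda>n. \<not> maker_wins (rc_board (s n) n) (rc_winning_sets (s n) n)
     (nat \<lfloor>(1 + \<epsilon>) * real (s n) * real n / ln (real n)\<rfloor>)) sequentially"
    using range growth \<epsilon> by (rule eventually_breaker_wins_rc)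
  ultimately show "eventually (\<lambda>n.
      (1/2 - \<epsilon>) * real (s n) * real n / ln (real n) \<le> real (rc_threshold (s n) n) \<and>
      real (rc_threshold (s n) n) \<le> (1 + \<epsilon>) * real (s n) * real n / ln (real n)) sequentially"
    using eventually_gt_at_top[of 1]
  proof eventually_elim
    case (elim n)
    let ?B = "\<lambda>b. \<not> maker_wins (rc_board (s n) n) (rc_winning_sets (s n) n) b"
    let ?u = "(1 + \<epsilon>) * real (s n) * real n / ln (real n)"
    have l: "0 < ln (real n)" using elim(3) by simp
    have th: "rc_threshold (s n) n = (LEAST b. ?B b)" by (simp add: rc_threshold_def threshold_bias_def)
    have "rc_threshold (s n) n \<le> nat \<lfloor>?u\<rfloor>" unfolding th using elim(2) by (rule Least_le)
    moreover have "0 \<le> ?u" using \<epsilon> l by simp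
    ultimately have upper: "real (rc_threshold (s n) n) \<le> ?u" by linarith
    \<comment> \<open>The threshold is itself a win for Breaker, so it lies above the whole range of
      biases in which Maker wins.\<close>
    have "?B (rc_threshold (s n) n)" unfolding th using elim(2) by (rule LeastI)
    then have "(1/2 - e) * real (s n) * real n / ln (real n) < real (rc_threshold (s n) n)"
      using elim(1) by force
    moreover have "(1/2 - \<epsilon>) * real (s n) * real n / ln (real n) \<le> (1/2 - e) * real (s n) * real n / ln (real n)"
      using e(3) l by (intro divide_right_mono mult_right_mono) auto
    ultimately show ?case using upper by linarith
  qed
qed

end
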